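(* Let $(G,X)$ be a second-countable transformation group. Let $z\in X$ with $G\cdot z$ locally closed in $X$ and $S_z$ compact. Assume that $(x_n)_{n\geq 1}$ is a sequence in $X$ such that $S_{x_n}\to S_z$ in $\Sigma$, that $S_z$ and all $S_{x_n}$ are normal in $G$, and that $G\cdot z$ is the unique limit of $(G\cdot x_n)_n$ in $X/G$. Let $k$ be a positive integer, and suppose that there exists a sequence $(W_m)_{m\geq 1}$ of compact neighbourhoods of $z$, forming a neighbourhood base at $z$, with $W_{m+1}\subset W_m$, such that, for each $m$, \[\liminf_n\nu_{x_n}(q_{x_n}(\phi_{x_n}^{-1}(W_m)))>(k-1)\,\nu_z(q_z(\phi_z^{-1}(W_m))).\] Then $(x_n)$ converges $k$-times in $X/G$ to $z$.
   Context: Transformation group: a second-countable transformation group $(G,X)$ is a second-countable locally compact Hausdorff group $G$ with a (jointly) continuous action $(s,x)\mapsto s\cdot x$ on a second-countable locally compact Hausdorff space $X$. $X/G$ is the orbit space with the quotient topology. A subset is locally closed if it is relatively open in its closure. Stability subgroups and maps: for $x\in X$, $S_x=\{s\in G: s\cdot x=x\}$; $q_x:G\to G/S_x$ is the quotient map, $\dot s=sS_x$; $\phi_x:G\to X$ is $\phi_x(s)=s\cdot x$. Fell topology: $\Sigma$ is the set of closed subgroups of $G$ with the topology having as a basis the sets $U(C,F)=\{H\in\Sigma: C\cap H=\emptyset,\ H\cap A\neq\emptyset \text{ for each } A\in F\}$, $C\subset G$ compact and $F$ a finite family of non-empty open subsets of $G$. Measures: $\mu$ is a fixed left Haar measure on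 $G$. Fix $f_0\in C_c(G)$ with $f_0(e)=1$, $0\leq f_0\leq 1$; for $H\in\Sigma$, $\alpha_H$ is the left Haar measure on $H$ with $\int_H f_0\,d\alpha_H=1$. For $H$ normal, $\nu_H$ is the right-invariant Haar measure on $G/H$ satisfying $\int_G f(s)\,d\mu(s)=\int_{G/H}\int_H f(st)\,d\alpha_H(t)\,d\nu_H(\dot s)$ for all $f\in C_c(G)$; the measures $\nu_x:=\nu_{S_x}$ for $x=z$ and $x=x_n$ are given measures with these two properties. $k$-times convergence: $(x_n)$ converges $k$-times in $X/G$ to $z$ if there are $k$ sequences $(t_n^{(1)})_n,\dots,(t_n^{(k)})_n$ in $G$ such that (i) $t_n^{(i)}\cdot x_n\to z$ as $n\to\infty$ for $1\leq i\leq k$; and (ii) if $1\leq i<j\leq k$ then for every compact $K\subset G$ the set $t_n^{(j)}(t_n^{(i)})^{-1}S_{x_n}$ is disjoint from $K$ for all sufficiently large $n$. *)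

theory Defs
  imports "HOL-Analysis.Analysis" "HOL-Algebra.Group_Action"
begin

subsection \<open>Second-countable transformation groups\<close>

text \<open>
  The group and the space on which it acts are whole types, carrying the type-class topology; hence
  the carrier is \<open>UNIV\<close>, and \<open>\<phi> s x\<close> is the paper's \<open>s \<cdot> x\<close>.
\<close>

locale transformation_group = group_action G UNIV \<phi>
  for G :: "'g::{second_countable_topology,t2_space} monoid" (structure)
    and \<phi> :: "'g \<Rightarrow> 'x::{second_countable_topology,t2_space} \<Rightarrow> 'x" +
  assumes carrier_UNIV: "carrier G = UNIV"
    and continuous_mult: "continuous_on UNIV (\<lambda>(s, t). s \<otimes> t)"
    and continuous_inv: "continuous_on UNIV (\<lambda>s. inv s)"
    and locally_compact_group: "locally_compact_space (euclidean :: 'g topology)"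
    and locally_compact_points: "locally_compact_space (euclidean :: 'x topology)"
    and continuous_action: "continuous_on UNIV (\<lambda>(s, x). \<phi> s x)"


subsection \<open>Quotient topologies\<close>

definition quotient_topology :: "'a topology \<Rightarrow> ('a \<Rightarrow> 'b) \<Rightarrow> 'b topology" where
  "quotient_topology T q =
     topology (\<lambda>U. U \<subseteq> q ` topspace T \<and> openin T {x \<in> topspace T. q x \<in> U})"

lemma openin_quotient_topology:
  "openin (quotient_topology T q) U \<longleftrightarrow>
     U \<subseteq> q ` topspace T \<and> openin T {x \<in> topspace T. q x \<in> U}"
proof -
  have "istopology (\<lambda>U. U \<subseteq> q ` topspace T \<and> openin T {x \<in> topspace T. q x \<in> U})"
  proof -
    have int: "{x \<in> topspace T. q x \<in> U \<inter> V} =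
        {x \<in> topspace T. q x \<in> U} \<inter> {x \<in> topspace T. q x \<in> V}" for U V
      by blast
    have un: "{x \<in> topspace T. q x \<in> \<Union>\<K>} = (\<Union>U\<in>\<K>. {x \<in> topspace T. q x \<in> U})" for \<K>
      by blast
    show ?thesis
      unfolding istopology_def int un
      by (intro conjI allI impI openin_Int openin_Union Sup_least le_infI1) auto
  qed
  then show ?thesis
    by (simp add: quotient_topology_def topology_inverse')
qed

lemma topspace_quotient_topology: "topspace (quotient_topology T q) = q ` topspace T"
proof
  show "topspace (quotient_topology T q) \<subseteq> q ` topspace T"
    using openin_topspace[of "quotient_topology T q"] by (simp only: openin_quotient_topology)
  have "{x \<in> topspace T. q x \<in> q ` topspace T} = topspace T" by blast
  then have "openin (quotient_topology T q) (q ` topspace T)"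
    by (simp add: openin_quotient_topology)
  then show "q ` topspace T \<subseteq> topspace (quotient_topology T q)"
    by (rule openin_subset)
qed

lemma quotient_map_quotient_topology: "quotient_map T (quotient_topology T q) q"
  by (simp add: quotient_map_def topspace_quotient_topology openin_quotient_topology)

definition orbit_space ::
    "'g monoid \<Rightarrow> ('g \<Rightarrow> 'x::topological_space \<Rightarrow> 'x) \<Rightarrow> 'x set topology" where
  "orbit_space G \<phi> = quotient_topology euclidean (orbit G \<phi>)"

definition coset_map :: "'g monoid \<Rightarrow> 'g set \<Rightarrow> 'g \<Rightarrow> 'g set" where
  "coset_map G H s = s <#\<^bsub>G\<^esub> H"

text \<open>
  The carrier of \<open>G Mod H\<close> consists of right cosets; for normal \<open>H\<close> it is the point set of the
  following topology.
\<close>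

definition coset_topology :: "'g::topological_space monoid \<Rightarrow> 'g set \<Rightarrow> 'g set topology" where
  "coset_topology G H = quotient_topology euclidean (coset_map G H)"


subsection \<open>The Fell topology on closed subgroups\<close>

definition closed_subgroups :: "'g::topological_space monoid \<Rightarrow> 'g set set" where
  "closed_subgroups G = {H. subgroup H G \<and> closed H}"

definition fell_basic ::
    "'g::topological_space monoid \<Rightarrow> 'g set \<Rightarrow> 'g set set \<Rightarrow> 'g set set" where
  "fell_basic G C F = {H \<in> closed_subgroups G. C \<inter> H = {} \<and> (\<forall>A\<in>F. H \<inter> A \<noteq> {})}"

definition is_fell_basic :: "'g::topological_space monoid \<Rightarrow> 'g set set \<Rightarrow> bool" where
  "is_fell_basic G U \<longleftrightarrow>
     (\<exists>C F. compact C \<and> finite F \<and> (\<forall>A\<in>F. open A \<and> A \<noteq> {}) \<and> U = fell_basic G C F)"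

definition fell_topology :: "'g::topological_space monoid \<Rightarrow> 'g set topology" where
  "fell_topology G = topology (arbitrary union_of is_fell_basic G)"

lemma openin_fell_topology:
  "openin (fell_topology G) = arbitrary union_of is_fell_basic G"
proof -
  have "is_fell_basic G (U \<inter> V)" if U: "is_fell_basic G U" and V: "is_fell_basic G V" for U V
  proof -
    obtain C F where CF: "compact C" "finite F" "\<forall>A\<in>F. open A \<and> A \<noteq> {}" "U = fell_basic G C F"
      using U unfolding is_fell_basic_def by blast
    obtain D E where DE: "compact D" "finite E" "\<forall>A\<in>E. open A \<and> A \<noteq> {}" "V = fell_basic G D E"
      using V unfolding is_fell_basic_def by blast
    have "U \<inter> V = fell_basic G (C \<union> D) (F \<union> E)"
      unfolding CF(4) DE(4) fell_basic_def by (auto simp: Int_Un_distrib2)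
    moreover have "compact (C \<union> D)" "finite (F \<union> E)" "\<forall>A\<in>F \<union> E. open A \<and> A \<noteq> {}"
      using CF DE by auto
    ultimately show ?thesis
      unfolding is_fell_basic_def by (intro exI[of _ "C \<union> D"] exI[of _ "F \<union> E"]) simp
  qed
  then have "istopology (arbitrary union_of is_fell_basic G)"
    by (rule istopology_base)
  then show ?thesis
    by (simp add: fell_topology_def topology_inverse')
qed

lemma topspace_fell_topology: "topspace (fell_topology G) = closed_subgroups G"
proof
  have "U \<subseteq> closed_subgroups G" if U: "openin (fell_topology G) U" for U
  proof -
    have sub: "V \<subseteq> closed_subgroups G" if "is_fell_basic G V" for V
      using that unfolding is_fell_basic_def fell_basic_def by blast
    obtain \<U> where "\<U> \<subseteq> Collect (is_fell_basic G)" "\<Union>\<U> = U"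
      using U unfolding openin_fell_topology union_of_def by blast
    then show ?thesis using sub by blast
  qed
  from this[OF openin_topspace] show "topspace (fell_topology G) \<subseteq> closed_subgroups G" .
  have "is_fell_basic G (fell_basic G {} {})"
    unfolding is_fell_basic_def by (intro exI[of _ "{}"]) simp
  moreover have "fell_basic G {} {} = closed_subgroups G" by (simp add: fell_basic_def)
  ultimately have "is_fell_basic G (closed_subgroups G)" by simp
  then have "openin (fell_topology G) (closed_subgroups G)"
    by (simp only: openin_fell_topology arbitrary_union_of_inc)
  then show "closed_subgroups G \<subseteq> topspace (fell_topology G)" by (rule openin_subset)
qed


subsection \<open>Haar measures\<close>

definition Cc :: "('a::topological_space \<Rightarrow> 'b::real_normed_vector) set" where
  "Cc = {f. continuous_on UNIV f \<and> compact (closure {x. f x \<noteq> 0})}"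

definition radon_measure :: "'a topology \<Rightarrow> 'a measure \<Rightarrow> bool" where
  "radon_measure T M \<longleftrightarrow>
     space M = topspace T \<and>
     sets M = sigma_sets (topspace T) {U. openin T U} \<and>
     (\<forall>K. compactin T K \<longrightarrow> emeasure M K < \<infinity>) \<and>
     (\<forall>A\<in>sets M. emeasure M A = (INF U\<in>{U. openin T U \<and> A \<subseteq> U}. emeasure M U)) \<and>
     (\<forall>U. openin T U \<longrightarrow> emeasure M U = (SUP K\<in>{K. compactin T K \<and> K \<subseteq> U}. emeasure M K))"

definition left_haar_measure :: "'a monoid \<Rightarrow> 'a topology \<Rightarrow> 'a measure \<Rightarrow> bool" where
  "left_haar_measure K T M \<longleftrightarrow>
     radon_measure T M \<and> emeasure M (space M) \<noteq> 0 \<and>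
     (\<forall>s\<in>carrier K. \<forall>A\<in>sets M. emeasure M (s <#\<^bsub>K\<^esub> A) = emeasure M A)"

definition right_haar_measure :: "'a monoid \<Rightarrow> 'a topology \<Rightarrow> 'a measure \<Rightarrow> bool" where
  "right_haar_measure K T M \<longleftrightarrow>
     radon_measure T M \<and> emeasure M (space M) \<noteq> 0 \<and>
     (\<forall>s\<in>carrier K. \<forall>A\<in>sets M. emeasure M (A #>\<^bsub>K\<^esub> s) = emeasure M A)"

text \<open>
  \<open>\<alpha> H\<close> is a measure on the set \<open>H\<close> itself, with its subspace topology.
\<close>

definition normalized_haar_family ::
    "'g::topological_space monoid \<Rightarrow> ('g \<Rightarrow> real) \<Rightarrow> ('g set \<Rightarrow> 'g measure) \<Rightarrow> bool" where
  "normalized_haar_family G f0 \<alpha> \<longleftrightarrow>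
     (\<forall>H\<in>closed_subgroups G.
        left_haar_measure (G\<lparr>carrier := H\<rparr>) (top_of_set H) (\<alpha> H) \<and>
        (\<integral>t. f0 t \<partial>\<alpha> H) = 1)"

text \<open>
  The inner integral \<open>\<integral>\<^sub>H f (st) d\<alpha>\<^sub>H(t)\<close> depends only on the coset \<open>C = sH\<close>, by left invariance of
  \<open>\<alpha>\<^sub>H\<close>; in the formula it is evaluated at an arbitrary \<open>s \<in> C\<close>.
\<close>

definition compatible_quotient_haar ::
    "'g::topological_space monoid \<Rightarrow> 'g measure \<Rightarrow> 'g measure \<Rightarrow> 'g set \<Rightarrow> 'g set measure \<Rightarrow> bool"
    where
  "compatible_quotient_haar G \<mu> \<alpha>H H \<nu> \<longleftrightarrow>
     right_haar_measure (G Mod H) (coset_topology G H) \<nu> \<and>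
     (\<forall>f :: 'g \<Rightarrow> complex. f \<in> Cc \<longrightarrow>
        (\<integral>s. f s \<partial>\<mu>) = (\<integral>C. (\<integral>t. f ((SOME s. s \<in> C) \<otimes>\<^bsub>G\<^esub> t) \<partial>\<alpha>H) \<partial>\<nu>))"


subsection \<open>Convergence with multiplicity in the orbit space\<close>

definition k_times_convergent ::
    "'g::topological_space monoid \<Rightarrow> ('g \<Rightarrow> 'x::topological_space \<Rightarrow> 'x) \<Rightarrow> nat \<Rightarrow>
     (nat \<Rightarrow> 'x) \<Rightarrow> 'x \<Rightarrow> bool" where
  "k_times_convergent G \<phi> k x z \<longleftrightarrow>
     (\<exists>t :: nat \<Rightarrow> nat \<Rightarrow> 'g.
        (\<forall>i\<in>{1..k}. (\<forall>n. t i n \<in> carrier G) \<and> (\<lambda>n. \<phi> (t i n) (x n)) \<longlonglongrightarrow> z) \<and>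
        (\<forall>i j. 1 \<le> i \<and> i < j \<and> j \<le> k \<longrightarrow>
           (\<forall>K. compact K \<longrightarrow>
              (\<forall>\<^sub>F n in sequentially.
                 ((t j n \<otimes>\<^bsub>G\<^esub> inv\<^bsub>G\<^esub> t i n) <#\<^bsub>G\<^esub> stabilizer G \<phi> (x n)) \<inter> K = {}))))"

end

theory Submission
  imports Defs
begin

text \<open>
  If every translate \<open>K s\<close> with \<open>s \<cdot> x\<^sub>n \<in> W\<close> carries less than a \<open>(k-1)\<close>-th part of the mass of the
  return set \<open>{s. s \<cdot> x\<^sub>n \<in> W}\<close> in \<open>G/S\<^bsub>x\<^sub>n\<^esub>\<close>, then \<open>k\<close> returns avoiding each other's translates can be
  chosen greedily. By right invariance that bound follows from upper semicontinuity: for compact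
  \<open>A\<close>, the limes superior of \<open>\<nu>\<^bsub>x\<^sub>n\<^esub> (q\<^bsub>x\<^sub>n\<^esub> A')\<close> over sets \<open>A'\<close> near \<open>A\<close> is at most \<open>\<nu>\<^sub>z (q\<^sub>z A)\<close>.

  For the semicontinuity take \<open>h \<in> C\<^sub>c(G)\<close> with \<open>h = 1\<close> near \<open>A S\<^sub>z\<close>, supported where \<open>\<nu>\<^sub>z\<close> is only
  slightly larger. Disintegrating the same number \<open>\<integral>h d\<mu>\<close> over \<open>G/S\<^sub>z\<close> and over \<open>G/S\<^bsub>x\<^sub>n\<^esub>\<close> reduces
  the claim to a lower bound for the mass of \<open>S\<^bsub>x\<^sub>n\<^esub>\<close> near \<open>S\<^sub>z\<close>. Since \<open>S\<^sub>z\<close> is compact, the part of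
  \<open>S\<^bsub>x\<^sub>n\<^esub>\<close> near \<open>S\<^sub>z\<close> is eventually a compact open subgroup \<open>L\<close>, and averaging \<open>f\<^sub>0(u\<inverse> l)\<close> over
  \<open>S\<^sub>z \<times> L\<close> in both orders compares the two Haar measures.
\<close>

subsection \<open>Topological preliminaries\<close>

text \<open>Compactness is used twice. Over a fixed point of \<open>A\<close> finitely many boxes
  cover \<open>B\<close>, and their first sides are intersected; finitely many of the resulting
  strips cover \<open>A\<close>, and now the second sides are intersected.\<close>

lemma tube_compact_compact:
  fixes A :: "'a::topological_space set" and B :: "'b::topological_space set"
  assumes "compact A" "compact B" "open W" "A \<times> B \<subseteq> W"
  obtains U V where "open U" "open V" "A \<subseteq> U" "B \<subseteq> V" "U \<times> V \<subseteq> W"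
proof -
  have "\<exists>X Y. open X \<and> open Y \<and> a \<in> X \<and> B \<subseteq> Y \<and> X \<times> Y \<subseteq> W" if "a \<in> A" for a
  proof -
    have "\<exists>X Y. open X \<and> open Y \<and> a \<in> X \<and> b \<in> Y \<and> X \<times> Y \<subseteq> W" if "b \<in> B" for b
    proof -
      have "(a, b) \<in> W" using \<open>a \<in> A\<close> that assms(4) by auto
      then show ?thesis using assms(3) unfolding open_prod_def
        by (metis mem_Times_iff fst_conv snd_conv)
    qed
    then obtain X Y where XY: "\<And>b. b \<in> B \<Longrightarrow> open (X b) \<and> open (Y b) \<and> a \<in> X b \<and> b \<in> Y b \<and> X b \<times> Y b \<subseteq> W"
      by metis
    obtain F where F: "F \<subseteq> B" "finite F" "B \<subseteq> (\<Union>b\<in>F. Y b)"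
      using compactE_image[OF assms(2), of B Y] XY by blast
    show ?thesis
      by (rule exI[of _ "\<Inter>b\<in>F. X b"], rule exI[of _ "\<Union>b\<in>F. Y b"])
        (use XY F in \<open>auto intro!: open_INT\<close>, blast)
  qed
  then obtain X Y where XY: "\<And>a. a \<in> A \<Longrightarrow> open (X a) \<and> open (Y a) \<and> a \<in> X a \<and> B \<subseteq> Y a \<and> X a \<times> Y a \<subseteq> W"
    by metis
  obtain F where F: "F \<subseteq> A" "finite F" "A \<subseteq> (\<Union>a\<in>F. X a)"
    using compactE_image[OF assms(1), of A X] XY by blast
  show ?thesis
    by (rule that[of "\<Union>a\<in>F. X a" "\<Inter>a\<in>F. Y a"])
      (use XY F in \<open>auto intro!: open_INT\<close>, blast+)
qed

lemma Hausdorff_euclidean: "Hausdorff_space (euclidean :: 'a::t2_space topology)"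
  unfolding Hausdorff_space_def by (simp add: disjnt_def separation_t2)

text \<open>A compact neighbourhood \<open>L\<close> of \<open>A\<close> may leave
  \<open>O'\<close>, but \<open>A\<close> and the compact set \<open>L - O'\<close> have disjoint
  open neighbourhoods, and cutting down to the first one keeps the closure away from
  \<open>L - O'\<close>.\<close>

lemma compact_between:
  fixes A :: "'a::t2_space set"
  assumes lc: "locally_compact_space (euclidean :: 'a topology)"
    and "compact A" "open O'" "A \<subseteq> O'"
  obtains U where "open U" "A \<subseteq> U" "compact (closure U)" "closure U \<subseteq> O'"
proof -
  have H: "Hausdorff_space (euclidean :: 'a topology)" by (rule Hausdorff_euclidean)
  obtain U L where UL: "open U" "compact L" "A \<subseteq> U" "U \<subseteq> L"
    using lc assms(2) unfolding locally_compact_space_compact_closed_compact[OF disjI1[OF H]]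
    by auto
  have D: "compact (L - O')" using UL assms(3) by (simp add: compact_diff)
  have "\<exists>P Q. openin euclidean P \<and> openin euclidean Q \<and> A \<subseteq> P \<and> (L - O') \<subseteq> Q \<and> disjnt P Q"
    using H[unfolded Hausdorff_space_compact_sets, rule_format, of A "L - O'"] assms(2,4) D
    by (force simp: disjnt_def)
  then obtain P Q where PQ: "open P" "open Q" "A \<subseteq> P" "L - O' \<subseteq> Q" "P \<inter> Q = {}"
    by (auto simp: disjnt_def)
  have "closure (U \<inter> P) \<subseteq> L \<inter> - Q"
    using UL PQ by (intro closure_minimal) (auto simp: compact_imp_closed)
  then have "closure (U \<inter> P) \<subseteq> L" "closure (U \<inter> P) \<subseteq> O'" using PQ(4) by auto
  moreover have "compact (closure (U \<inter> P))"
    using compact_Int_closed[OF UL(2), of "closure (U \<inter> P)"] calculation(1)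
    by (simp add: inf.absorb2)
  ultimately show ?thesis using that[of "U \<inter> P"] UL PQ by auto
qed

text \<open>Two sets are interpolated: \<open>h\<close> is 1 on the closure of \<open>U\<close>,
  thus on a whole neighbourhood of \<open>A\<close>, and it vanishes off \<open>V\<close>, whose
  compact closure inside \<open>O'\<close> bounds the support.\<close>

lemma Urysohn_Cc:
  fixes A :: "'a::t2_space set"
  assumes lc: "locally_compact_space (euclidean :: 'a topology)"
    and "compact A" "open O'" "A \<subseteq> O'"
  obtains h :: "'a \<Rightarrow> real" and U where "h \<in> Cc" "\<And>s. 0 \<le> h s \<and> h s \<le> 1" "open U" "A \<subseteq> U"
    "\<And>s. s \<in> U \<Longrightarrow> h s = 1" "\<And>s. s \<notin> O' \<Longrightarrow> h s = 0"
proof -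
  obtain U where U: "open U" "A \<subseteq> U" "compact (closure U)" "closure U \<subseteq> O'"
    using compact_between[OF assms] .
  obtain V where V: "open V" "closure U \<subseteq> V" "compact (closure V)" "closure V \<subseteq> O'"
    using compact_between[OF lc U(3) assms(3) U(4)] .
  have H: "Hausdorff_space (euclidean :: 'a topology)" by (rule Hausdorff_euclidean)
  have cr: "completely_regular_space (euclidean :: 'a topology)"
    using H lc locally_compact_Hausdorff_imp_regular_space
      locally_compact_regular_imp_completely_regular_space by blast
  obtain h where h: "continuous_map euclidean (top_of_set {0..1::real}) h" "h ` (- V) \<subseteq> {0}" "h ` closure U \<subseteq> {1}"
    by (rule Urysohn_completely_regular_compact_closed[of 0 1 "euclidean :: 'a topology" "closure U" "- V"])
      (use cr U V in \<open>auto simp: disjnt_def\<close>)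
  have c: "continuous_on UNIV h" and r: "\<And>s. h s \<in> {0..1}"
    using h(1) by (auto simp: continuous_map_in_subtopology Pi_iff)
  have z: "h s = 0" if "s \<notin> V" for s using h(2) that by auto
  then have "closure {s. h s \<noteq> 0} \<subseteq> closure V" by (intro closure_mono) auto
  then have "compact (closure {s. h s \<noteq> 0})"
    using compact_Int_closed[OF V(3), of "closure {s. h s \<noteq> 0}"] by (simp add: inf.absorb2)
  then have "h \<in> Cc" using c by (simp add: Cc_def)
  moreover have "h s = 1" if "s \<in> U" for s using h(3) that closure_subset[of U] by auto
  moreover have "h s = 0" if "s \<notin> O'" for s using z V that closure_subset[of V] by auto
  ultimately show ?thesis using that[of h U] r U by auto
qed

text \<open>The tube lemma over \<open>D \<times> {v0}\<close>. With \<open>F\<close> the difference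
  between a translate of \<open>f\<close> and \<open>f\<close> itself it yields uniform continuity
  of \<open>f\<close> on compact sets, on either side.\<close>

lemma uniform_near_compact:
  fixes F :: "'a::topological_space \<Rightarrow> 'b::topological_space \<Rightarrow> real"
  assumes "continuous_on UNIV (\<lambda>(p, v). F p v)" "compact D" "\<And>p. p \<in> D \<Longrightarrow> F p v0 = 0" "e > 0"
  obtains N where "open N" "v0 \<in> N" "\<And>p v. p \<in> D \<Longrightarrow> v \<in> N \<Longrightarrow> \<bar>F p v\<bar> < e"
proof -
  let ?W = "(\<lambda>(p, v). F p v) -` {-e<..<e}"
  have "open ?W" using assms(1) by (simp add: open_vimage)
  moreover have "D \<times> {v0} \<subseteq> ?W" using assms(3,4) by auto
  ultimately obtain U V where UV: "open U" "open V" "D \<subseteq> U" "{v0} \<subseteq> V" "U \<times> V \<subseteq> ?W"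
    using tube_compact_compact[OF assms(2), of "{v0}" ?W] by auto
  show ?thesis
  proof (rule that[of V])
    fix p v assume "p \<in> D" "v \<in> V"
    then have "(p, v) \<in> ?W" using UV by blast
    then show "\<bar>F p v\<bar> < e" by auto
  qed (use UV in auto)
qed

lemma Cc_support:
  assumes "f \<in> Cc"
  obtains D where "compact D" "\<And>s. s \<notin> D \<Longrightarrow> f s = 0"
proof (rule that)
  show "compact (closure {s. f s \<noteq> 0})" using assms by (simp add: Cc_def)
  show "f s = 0" if "s \<notin> closure {s. f s \<noteq> 0}" for s
    using that closure_subset[of "{s. f s \<noteq> 0}"] by auto
qed

lemma Cc_bounded:
  fixes f :: "'a::topological_space \<Rightarrow> real"
  assumes "f \<in> Cc"
  obtains B where "\<And>s. \<bar>f s\<bar> \<le> B"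
proof -
  obtain D where D: "compact D" "\<And>s. s \<notin> D \<Longrightarrow> f s = 0" using Cc_support[OF assms] by blast
  have "compact (f ` D)"
    using assms D(1) unfolding Cc_def by (auto intro: compact_continuous_image continuous_on_subset)
  then obtain B where B: "\<And>s. s \<in> D \<Longrightarrow> \<bar>f s\<bar> \<le> B"
    using compact_imp_bounded[of "f ` D"] unfolding bounded_iff by auto
  have "\<bar>f s\<bar> \<le> max B 0" for s
    using B[of s] D(2)[of s] by (cases "s \<in> D") auto
  then show ?thesis using that by blast
qed

lemma Cc_continuous: "f \<in> Cc \<Longrightarrow> continuous_on UNIV f"
  by (simp add: Cc_def)

lemma Cc_borel_measurable:
  fixes f :: "'a::topological_space \<Rightarrow> real"
  shows "f \<in> Cc \<Longrightarrow> f \<in> borel_measurable borel"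
  by (simp add: Cc_continuous borel_measurable_continuous_onI)

section \<open>Locally compact groups and products of subsets\<close>

locale lc_group = group G for G :: "'g::{second_countable_topology,t2_space} monoid" (structure) +
  assumes carrier_UNIV: "carrier G = UNIV"
    and continuous_mult: "continuous_on UNIV (\<lambda>(s, t). s \<otimes> t)"
    and continuous_inv: "continuous_on UNIV (\<lambda>s. inv s)"
    and locally_compact_group: "locally_compact_space (euclidean :: 'g topology)"
begin

lemma in_carrier [simp]: "s \<in> carrier G"
  by (simp add: carrier_UNIV)

lemma mult_inv_cancel [simp]: "s \<otimes> (inv s \<otimes> t) = t" "inv s \<otimes> (s \<otimes> t) = t"
  by (simp_all flip: m_assoc)

lemma continuous_on_group_mult [continuous_intros]:
  assumes "continuous_on S f" "continuous_on S g"
  shows "continuous_on S (\<lambda>x. f x \<otimes> g x)"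
  using continuous_on_compose2[OF continuous_mult continuous_on_Pair[OF assms]] by simp

lemma continuous_on_group_inv [continuous_intros]:
  assumes "continuous_on S f"
  shows "continuous_on S (\<lambda>x. inv f x)"
  using continuous_on_compose2[OF continuous_inv assms] by simp

lemma tendsto_group_mult [tendsto_intros]:
  assumes "(f \<longlongrightarrow> a) F" "(g \<longlongrightarrow> b) F"
  shows "((\<lambda>x. f x \<otimes> g x) \<longlongrightarrow> a \<otimes> b) F"
proof -
  have "isCont (\<lambda>(s, t). s \<otimes> t) (a, b)"
    using continuous_mult by (simp add: continuous_on_eq_continuous_at)
  from isCont_tendsto_compose[OF this tendsto_Pair[OF assms]] show ?thesis by simp
qed

lemma tendsto_group_inv [tendsto_intros]:
  assumes "(f \<longlongrightarrow> a) F"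
  shows "((\<lambda>x. inv f x) \<longlongrightarrow> inv a) F"
proof -
  have "isCont (\<lambda>s. inv s) a"
    using continuous_inv by (simp add: continuous_on_eq_continuous_at)
  from isCont_tendsto_compose[OF this assms] show ?thesis .
qed

lemma open_translate: "open A \<Longrightarrow> open {s. u \<otimes> s \<in> A}"
  using open_vimage[of A "\<lambda>s. u \<otimes> s"] by (simp add: vimage_def continuous_intros)

lemma set_multI: "a \<in> A \<Longrightarrow> b \<in> B \<Longrightarrow> a \<otimes> b \<in> A <#> B"
  unfolding set_mult_def by blast

text \<open>Second countability permits sequences: the factors in \<open>A\<close> have a convergent
  subsequence, and dividing by it makes the factors in \<open>H\<close> converge too.\<close>

lemma closed_set_mult:
  assumes "compact A" "closed H"
  shows "closed (A <#> H)"
  unfolding closed_sequential_limits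
proof safe
  fix g l assume g: "\<forall>n::nat. g n \<in> A <#> H" and l: "g \<longlonglongrightarrow> l"
  have "\<forall>n. \<exists>a h. a \<in> A \<and> h \<in> H \<and> g n = a \<otimes> h"
    using g unfolding set_mult_def by blast
  then obtain a h where ah: "\<And>n. a n \<in> A" "\<And>n. h n \<in> H" "\<And>n. g n = a n \<otimes> h n" by metis
  obtain b r where r: "b \<in> A" "strict_mono (r::nat\<Rightarrow>nat)" "(a \<circ> r) \<longlonglongrightarrow> b"
    using seq_compactE[OF compact_imp_seq_compact[OF assms(1)]] ah(1) by metis
  have "(\<lambda>n. inv (a (r n)) \<otimes> g (r n)) \<longlonglongrightarrow> inv b \<otimes> l"
    using r(3) LIMSEQ_subseq_LIMSEQ[OF l r(2)] by (intro tendsto_intros) (auto simp: o_def)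
  moreover have "inv (a (r n)) \<otimes> g (r n) \<in> H" for n using ah by simp
  ultimately have "inv b \<otimes> l \<in> H" by (rule closed_sequentially[OF assms(2), rotated])
  with r(1) have "b \<otimes> (inv b \<otimes> l) \<in> A <#> H" by (rule set_multI)
  then show "l \<in> A <#> H" by simp
qed

lemma compact_set_mult:
  assumes "compact A" "compact B"
  shows "compact (A <#> B)"
proof -
  have "A <#> B = (\<lambda>(s, t). s \<otimes> t) ` (A \<times> B)" by (auto simp: set_mult_def)
  then show ?thesis
    using compact_continuous_image[OF continuous_on_subset[OF continuous_mult] compact_Times[OF assms]]
    by simp
qed

lemma compact_inv_image:
  assumes "compact A"
  shows "compact ((\<lambda>s. inv s) ` A)"
  using compact_continuous_image[OF continuous_on_subset[OF continuous_inv] assms] by simp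

end

subsection \<open>Invariant measures on subgroups\<close>

text \<open>Haar measures on a closed subgroup \<open>H\<close> are handled as Borel measures on \<open>G\<close> carried by \<open>H\<close>.\<close>

definition invariant_on :: "'g::topological_space monoid \<Rightarrow> 'g set \<Rightarrow> 'g measure \<Rightarrow> bool" where
  "invariant_on G H M \<longleftrightarrow>
     sets M = sets borel \<and> emeasure M (- H) = 0 \<and>
     (\<forall>K. compact K \<longrightarrow> emeasure M K < \<infinity>) \<and>
     (\<forall>s\<in>H. distr M borel (\<lambda>t. s \<otimes>\<^bsub>G\<^esub> t) = M)"

lemma invariant_on_AE:
  assumes "invariant_on G H M" "closed H"
  shows "AE t in M. t \<in> H"
proof (rule AE_I[of _ _ "- H"])
  show "- H \<in> sets M" using assms unfolding invariant_on_def by simp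
qed (use assms in \<open>auto simp: invariant_on_def\<close>)

lemma invariant_on_finite:
  assumes M: "invariant_on G H M" and "compact H" "closed H"
  shows "finite_measure M" "measure M UNIV = measure M H"
proof -
  have s: "space M = UNIV" using M sets_eq_imp_space_eq[of M borel] unfolding invariant_on_def by simp
  have "emeasure M UNIV = emeasure M H"
    using M \<open>closed H\<close> invariant_on_AE[OF M \<open>closed H\<close>] by (intro emeasure_eq_AE) (auto simp: invariant_on_def)
  moreover have "emeasure M H < \<infinity>" using M assms unfolding invariant_on_def by blast
  ultimately show "finite_measure M" "measure M UNIV = measure M H"
    by (auto intro!: finite_measureI simp: s measure_def)
qed

context lc_group
begin

lemma measurable_translate [measurable]: "(\<lambda>t. s \<otimes> t) \<in> borel \<rightarrow>\<^sub>M borel"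
  by (intro borel_measurable_continuous_onI continuous_intros)

lemma invariant_on_integral:
  fixes f :: "'g \<Rightarrow> real"
  assumes M: "invariant_on G H M" and "s \<in> H" "f \<in> borel_measurable borel"
  shows "(\<integral>t. f (s \<otimes> t) \<partial>M) = (\<integral>t. f t \<partial>M)"
proof -
  have sM: "sets M = sets borel" and d: "distr M borel (\<lambda>t. s \<otimes> t) = M"
    using M assms(2) unfolding invariant_on_def by auto
  have "(\<lambda>t. s \<otimes> t) \<in> M \<rightarrow>\<^sub>M borel" using measurable_translate measurable_cong_sets[OF sM refl] by blast
  from integral_distr[OF this assms(3)] show ?thesis unfolding d by simp
qed

text \<open>The push-forward along the inclusion gives a Borel set \<open>A\<close> the mass of
  \<open>A \<inter> H\<close>, so that measures on different subgroups live on one space and can be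
  compared.\<close>

lemma haar_invariant_on:
  assumes m: "left_haar_measure (G\<lparr>carrier := H\<rparr>) (top_of_set H) m"
    and H: "closed H" "subgroup H G"
  shows "(\<lambda>x. x) \<in> m \<rightarrow>\<^sub>M borel" "invariant_on G H (distr m borel (\<lambda>x. x))"
proof -
  have sp: "space m = H" and se: "sets m = sigma_sets H {U. openin (top_of_set H) U}"
    and fin: "\<And>K. compactin (top_of_set H) K \<Longrightarrow> emeasure m K < \<infinity>"
    and inv: "\<And>s A. s \<in> H \<Longrightarrow> A \<in> sets m \<Longrightarrow> emeasure m (s <#\<^bsub>G\<lparr>carrier := H\<rparr>\<^esub> A) = emeasure m A"
    using m unfolding left_haar_measure_def radon_measure_def by auto
  show id: "(\<lambda>x. x) \<in> m \<rightarrow>\<^sub>M borel"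
  proof (rule borel_measurableI)
    fix S :: "'g set" assume "open S"
    then have "openin (top_of_set H) (S \<inter> H)" by (simp add: openin_open_Int Int_commute)
    then show "(\<lambda>x. x) -` S \<inter> space m \<in> sets m" unfolding sp se by (auto intro: sigma_sets.Basic)
  qed
  let ?M = "distr m borel (\<lambda>x. x)"
  have em: "emeasure ?M A = emeasure m (A \<inter> H)" if "A \<in> sets borel" for A
    using emeasure_distr[OF id that] by (simp add: sp)
  have "emeasure ?M (- H) = 0" using em[of "- H"] H(1) by simp
  moreover have "emeasure ?M K < \<infinity>" if "compact K" for K
  proof -
    have "compact (K \<inter> H)" using that H(1) by blast
    then have "compactin (top_of_set H) (K \<inter> H)" by (simp add: compactin_subtopology)
    then show ?thesis using em[of K] fin that by (simp add: compact_imp_closed)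
  qed
  moreover have "distr ?M borel (\<lambda>t. s \<otimes> t) = ?M" if s: "s \<in> H" for s
  proof (rule measure_eqI)
    fix A assume "A \<in> sets (distr ?M borel (\<lambda>t. s \<otimes> t))"
    then have A: "A \<in> sets borel" by simp
    define A' where "A' = {t. s \<otimes> t \<in> A}"
    have A': "A' \<in> sets borel" using measurable_sets[OF measurable_translate A] by (simp add: A'_def vimage_def)
    have "A' \<inter> H \<in> sets m" using measurable_sets[OF id A'] by (simp add: sp)
    have "s <#\<^bsub>G\<lparr>carrier := H\<rparr>\<^esub> (A' \<inter> H) = A \<inter> H"
    proof safe
      fix t assume "t \<in> A" "t \<in> H"
      have "inv s \<otimes> t \<in> A' \<inter> H"
        using s \<open>t \<in> A\<close> \<open>t \<in> H\<close> H(2) by (simp add: A'_def subgroup.m_closed subgroup.m_inv_closed)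
      then show "t \<in> s <#\<^bsub>G\<lparr>carrier := H\<rparr>\<^esub> (A' \<inter> H)" unfolding l_coset_def by force
    qed (use s H(2) in \<open>auto simp: l_coset_def A'_def subgroup.m_closed\<close>)
    then have "emeasure m (A' \<inter> H) = emeasure m (A \<inter> H)"
      using inv[OF s \<open>A' \<inter> H \<in> sets m\<close>] by simp
    moreover have "emeasure (distr ?M borel (\<lambda>t. s \<otimes> t)) A = emeasure ?M A'"
      using A by (subst emeasure_distr) (auto simp: A'_def vimage_def)
    ultimately show "emeasure (distr ?M borel (\<lambda>t. s \<otimes> t)) A = emeasure ?M A"
      using em[OF A] em[OF A'] by simp
  qed simp
  ultimately show "invariant_on G H ?M" unfolding invariant_on_def by simp
qed

text \<open>Translation by an element of \<open>L\<close> preserves \<open>L\<close> and its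
  complement, hence commutes with restriction to \<open>L\<close>.\<close>

lemma invariant_on_restrict:
  assumes M: "invariant_on G H M" and L: "closed L" "subgroup L G" "L \<subseteq> H"
  shows "invariant_on G L (density M (indicator L))"
proof -
  have sM: "sets M = sets borel" and fin: "\<And>K. compact K \<Longrightarrow> emeasure M K < \<infinity>"
    and d: "\<And>s. s \<in> H \<Longrightarrow> distr M borel (\<lambda>t. s \<otimes> t) = M"
    using M unfolding invariant_on_def by auto
  have mt: "(\<lambda>t. s \<otimes> t) \<in> M \<rightarrow>\<^sub>M borel" for s
    using measurable_translate measurable_cong_sets[OF sM refl] by blast
  have LM: "L \<in> sets M" using L(1) sM by simp
  have em: "emeasure (density M (indicator L)) A = emeasure M (L \<inter> A)" if "A \<in> sets borel" for A
    using emeasure_restricted[OF LM] that sM by simp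
  have "emeasure (density M (indicator L)) K < \<infinity>" if "compact K" for K
    using em[of K] fin[of "L \<inter> K"] that L(1) by (simp add: compact_imp_closed closed_Int_compact)
  moreover have "emeasure (density M (indicator L)) (- L) = 0" using em[of "- L"] L(1) by simp
  moreover have "distr (density M (indicator L)) borel (\<lambda>t. s \<otimes> t) = density M (indicator L)"
    if s: "s \<in> L" for s
  proof (rule measure_eqI)
    fix A assume "A \<in> sets (distr (density M (indicator L)) borel (\<lambda>t. s \<otimes> t))"
    then have A: "A \<in> sets borel" by simp
    define A' where "A' = {t. s \<otimes> t \<in> A}"
    have A': "A' \<in> sets borel" using measurable_sets[OF measurable_translate A] by (simp add: A'_def vimage_def)
    have iff: "s \<otimes> t \<in> L \<longleftrightarrow> t \<in> L" for t
      using s L(2) subgroup.m_closed[OF L(2)] subgroup.m_inv_closed[OF L(2) s] by (metis mult_inv_cancel(2))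
    have "emeasure (distr (density M (indicator L)) borel (\<lambda>t. s \<otimes> t)) A
        = emeasure (density M (indicator L)) A'"
      using A mt by (subst emeasure_distr) (auto simp: A'_def vimage_def sets_eq_imp_space_eq[OF sM])
    also have "\<dots> = emeasure M (L \<inter> A')" by (rule em[OF A'])
    also have "L \<inter> A' = (\<lambda>t. s \<otimes> t) -` (L \<inter> A) \<inter> space M"
      using sets_eq_imp_space_eq[OF sM] by (auto simp: A'_def iff)
    also have "emeasure M \<dots> = emeasure (distr M borel (\<lambda>t. s \<otimes> t)) (L \<inter> A)"
      using A L(1) by (intro emeasure_distr[OF mt, symmetric]) auto
    also have "\<dots> = emeasure (density M (indicator L)) A"
      using d[of s] s L(3) em[OF A] by (simp add: subset_iff)
    finally show "emeasure (distr (density M (indicator L)) borel (\<lambda>t. s \<otimes> t)) A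
        = emeasure (density M (indicator L)) A" .
  qed (simp add: sM)
  ultimately show ?thesis unfolding invariant_on_def using sM by simp
qed

section \<open>Comparison of Haar measures on neighbouring compact groups\<close>

text \<open>Both iterated integrals of \<open>f (inv u \<otimes> l)\<close> are the same number
  \<open>J\<close>; the inner integrals are nearly the constants \<open>b\<close> and
  \<open>a\<close>, so \<open>J\<close> is close to both products.\<close>

lemma Fubini_compare:
  fixes f :: "'g \<Rightarrow> real"
  assumes f: "f \<in> Cc" and fin: "finite_measure \<alpha>" "finite_measure \<beta>"
    and s: "sets \<alpha> = sets borel" "sets \<beta> = sets borel"
    and AE: "AE u in \<alpha>. u \<in> A" "AE l in \<beta>. l \<in> B"
    and b: "\<And>u. u \<in> A \<Longrightarrow> \<bar>(\<integral>l. f (inv u \<otimes> l) \<partial>\<beta>) - b\<bar> \<le> e1"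
    and a: "\<And>l. l \<in> B \<Longrightarrow> \<bar>(\<integral>u. f (inv u \<otimes> l) \<partial>\<alpha>) - a\<bar> \<le> e2"
  shows "\<bar>measure \<alpha> UNIV * b - measure \<beta> UNIV * a\<bar> \<le> measure \<alpha> UNIV * e1 + measure \<beta> UNIV * e2"
proof -
  interpret a: finite_measure \<alpha> by fact
  interpret b: finite_measure \<beta> by fact
  interpret P: pair_sigma_finite \<alpha> \<beta> ..
  interpret PF: finite_measure "\<alpha> \<Otimes>\<^sub>M \<beta>" by (intro finite_measure_pair_measure fin)
  have sp: "space \<alpha> = UNIV" "space \<beta> = UNIV" using s[THEN sets_eq_imp_space_eq] by simp_all
  obtain C where C: "\<And>s. \<bar>f s\<bar> \<le> C" using Cc_bounded[OF f] by blast
  have "continuous_on UNIV (\<lambda>(u, l). f (inv u \<otimes> l))"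
    unfolding split_beta
    by (intro continuous_on_compose2[OF Cc_continuous[OF f]] continuous_intros) auto
  then have "(\<lambda>(u, l). f (inv u \<otimes> l)) \<in> borel_measurable (borel \<Otimes>\<^sub>M borel)"
    unfolding borel_prod by (rule borel_measurable_continuous_onI)
  then have meas: "(\<lambda>(u, l). f (inv u \<otimes> l)) \<in> borel_measurable (\<alpha> \<Otimes>\<^sub>M \<beta>)"
    using measurable_cong_sets[OF sets_pair_measure_cong[OF s] refl] by blast
  have int: "integrable (\<alpha> \<Otimes>\<^sub>M \<beta>) (\<lambda>(u, l). f (inv u \<otimes> l))"
    by (rule PF.integrable_const_bound[OF _ meas, of C]) (use C in auto)
  define J where "J = (\<integral>u. (\<integral>l. f (inv u \<otimes> l) \<partial>\<beta>) \<partial>\<alpha>)"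
  have J': "J = (\<integral>l. (\<integral>u. f (inv u \<otimes> l) \<partial>\<alpha>) \<partial>\<beta>)" unfolding J_def by (rule P.Fubini_integral[OF int, symmetric])
  have bound: "\<bar>(\<integral>x. g x \<partial>M) - measure M UNIV * c\<bar> \<le> measure M UNIV * e"
    if M: "finite_measure M" "space M = UNIV" and g: "integrable M g" and AE: "AE x in M. x \<in> S"
      and S: "\<And>x. x \<in> S \<Longrightarrow> \<bar>g x - c\<bar> \<le> e" for M :: "'g measure" and g c e S
  proof -
    interpret finite_measure M by fact
    have "(\<integral>x. g x - c \<partial>M) = (\<integral>x. g x \<partial>M) - measure M UNIV * c" using g M by simp
    moreover have "(\<integral>x. g x - c \<partial>M) \<le> (\<integral>x. e \<partial>M)"
      by (rule integral_mono_AE) (use g AE S in \<open>auto elim!: eventually_mono simp: abs_le_iff\<close>)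
    moreover have "(\<integral>x. - e \<partial>M) \<le> (\<integral>x. g x - c \<partial>M)"
      by (rule integral_mono_AE) (use g AE S in \<open>force elim!: eventually_mono simp: abs_le_iff\<close>)+
    ultimately show ?thesis using M by (simp add: abs_le_iff)
  qed
  have "\<bar>J - measure \<alpha> UNIV * b\<bar> \<le> measure \<alpha> UNIV * e1"
    unfolding J_def by (rule bound[OF fin(1) sp(1) P.integrable_fst[OF int] AE(1) b])
  moreover have "\<bar>J - measure \<beta> UNIV * a\<bar> \<le> measure \<beta> UNIV * e2"
    unfolding J' by (rule bound[OF fin(2) sp(2) P.integrable_snd[OF int] AE(2) a])
  ultimately show ?thesis by linarith
qed

text \<open>In \<open>f (inv u \<otimes> l)\<close> each variable is replaced by a nearby element of
  the other group, which left invariance then removes. For \<open>l\<close> replaced by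
  \<open>\<sigma>\<close> this works because
  \<open>inv u \<otimes> \<sigma> = inv (inv \<sigma> \<otimes> u)\<close>, and so the integral over
  \<open>\<alpha>\<close> keeps its inverse.\<close>

lemma invariant_compare:
  fixes f :: "'g \<Rightarrow> real"
  assumes f: "f \<in> Cc" and A: "compact A" "subgroup A G" "invariant_on G A \<alpha>"
    and B: "compact B" "subgroup B G" "invariant_on G B \<beta>"
    and near1: "\<And>u. u \<in> A \<Longrightarrow> \<exists>l'\<in>B. \<forall>l\<in>B. \<bar>f (inv u \<otimes> l) - f (inv l' \<otimes> l)\<bar> \<le> e"
    and near2: "\<And>l. l \<in> B \<Longrightarrow> \<exists>\<sigma>\<in>A. \<forall>u\<in>A. \<bar>f (inv u \<otimes> l) - f (inv u \<otimes> \<sigma>)\<bar> \<le> e"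
  shows "\<bar>measure \<alpha> A * (\<integral>l. f l \<partial>\<beta>) - measure \<beta> B * (\<integral>u. f (inv u) \<partial>\<alpha>)\<bar>
    \<le> 2 * e * measure \<alpha> A * measure \<beta> B"
proof -
  have cl: "closed A" "closed B" using A B by (auto simp: compact_imp_closed)
  note fin = invariant_on_finite[OF A(3,1) cl(1)] invariant_on_finite[OF B(3,1) cl(2)]
  have s: "sets \<alpha> = sets borel" "sets \<beta> = sets borel" using A B unfolding invariant_on_def by auto
  have sp: "space \<alpha> = UNIV" "space \<beta> = UNIV" using s[THEN sets_eq_imp_space_eq] by simp_all
  note AE = invariant_on_AE[OF A(3) cl(1)] invariant_on_AE[OF B(3) cl(2)]
  obtain C where C: "\<And>s. \<bar>f s\<bar> \<le> C" using Cc_bounded[OF f] by blast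
  have meas: "(\<lambda>u. f (p u)) \<in> borel_measurable borel" if "continuous_on UNIV p" for p
    by (intro borel_measurable_continuous_onI continuous_on_compose2[OF Cc_continuous[OF f] that]) auto
  have close: "\<bar>(\<integral>x. g x \<partial>M) - (\<integral>x. h x \<partial>M)\<bar> \<le> e * measure M S"
    if M: "finite_measure M" "sets M = sets borel" "AE x in M. x \<in> S" "measure M UNIV = measure M S"
      and gh: "g \<in> borel_measurable borel" "h \<in> borel_measurable borel" "\<And>x. \<bar>g x\<bar> \<le> C" "\<And>x. \<bar>h x\<bar> \<le> C"
        "\<And>x. x \<in> S \<Longrightarrow> \<bar>g x - h x\<bar> \<le> e"
    for M :: "'g measure" and g h S
  proof -
    interpret finite_measure M by fact
    have sp: "space M = UNIV" using M(2)[THEN sets_eq_imp_space_eq] by simp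
    have i: "integrable M g" "integrable M h"
      using gh M(2) by (auto intro!: integrable_const_bound[of _ C] simp: measurable_cong_sets[OF M(2) refl])
    have "(\<integral>x. g x \<partial>M) \<le> (\<integral>x. h x + e \<partial>M)"
      by (rule integral_mono_AE) (use i M(3) gh(5) in \<open>auto elim!: eventually_mono simp: abs_le_iff\<close>, force)
    moreover have "(\<integral>x. h x \<partial>M) \<le> (\<integral>x. g x + e \<partial>M)"
      by (rule integral_mono_AE) (use i M(3) gh(5) in \<open>auto elim!: eventually_mono simp: abs_le_iff\<close>, force)
    ultimately show ?thesis using i sp M(4) by (simp add: abs_le_iff algebra_simps)
  qed
  have 1: "\<bar>(\<integral>l. f (inv u \<otimes> l) \<partial>\<beta>) - (\<integral>l. f l \<partial>\<beta>)\<bar> \<le> e * measure \<beta> B" if u: "u \<in> A" for u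
  proof -
    obtain l' where l': "l' \<in> B" "\<And>l. l \<in> B \<Longrightarrow> \<bar>f (inv u \<otimes> l) - f (inv l' \<otimes> l)\<bar> \<le> e"
      using near1[OF u] by blast
    have "(\<integral>l. f (inv l' \<otimes> l) \<partial>\<beta>) = (\<integral>l. f l \<partial>\<beta>)"
      by (rule invariant_on_integral[OF B(3) subgroup.m_inv_closed[OF B(2) l'(1)] Cc_borel_measurable[OF f]])
    moreover have "\<bar>(\<integral>l. f (inv u \<otimes> l) \<partial>\<beta>) - (\<integral>l. f (inv l' \<otimes> l) \<partial>\<beta>)\<bar> \<le> e * measure \<beta> B"
      by (rule close[OF fin(3) s(2) AE(2) fin(4)]) (use C l'(2) in \<open>auto intro!: meas continuous_intros\<close>)
    ultimately show ?thesis by simp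
  qed
  have 2: "\<bar>(\<integral>u. f (inv u \<otimes> l) \<partial>\<alpha>) - (\<integral>u. f (inv u) \<partial>\<alpha>)\<bar> \<le> e * measure \<alpha> A" if l: "l \<in> B" for l
  proof -
    obtain \<sigma> where \<sigma>: "\<sigma> \<in> A" "\<And>u. u \<in> A \<Longrightarrow> \<bar>f (inv u \<otimes> l) - f (inv u \<otimes> \<sigma>)\<bar> \<le> e"
      using near2[OF l] by blast
    have "(\<integral>u. f (inv (inv \<sigma> \<otimes> u)) \<partial>\<alpha>) = (\<integral>u. f (inv u) \<partial>\<alpha>)"
      by (rule invariant_on_integral[OF A(3) subgroup.m_inv_closed[OF A(2) \<sigma>(1)]])
        (intro meas continuous_intros)
    moreover have "\<bar>(\<integral>u. f (inv u \<otimes> l) \<partial>\<alpha>) - (\<integral>u. f (inv u \<otimes> \<sigma>) \<partial>\<alpha>)\<bar> \<le> e * measure \<alpha> A"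
      by (rule close[OF fin(1) s(1) AE(1) fin(2)]) (use C \<sigma>(2) in \<open>auto intro!: meas continuous_intros\<close>)
    ultimately show ?thesis by (simp add: inv_mult_group)
  qed
  show ?thesis
    using Fubini_compare[OF f fin(1,3) s AE 1 2] unfolding fin(2,4) by (simp add: algebra_simps)
qed

text \<open>Both measures are normalised by the same \<open>f\<close>, whose support eventually
  meets \<open>Hn n\<close> only in the piece \<open>L\<close> near \<open>H\<close>. So
  \<open>f\<close> has integral 1 over \<open>L\<close> as well as over \<open>H\<close>, and
  \<open>invariant_compare\<close> relates the two masses.\<close>

lemma haar_liminf:
  fixes H :: "'g set" and f :: "'g \<Rightarrow> real"
  assumes Hn: "\<And>n. subgroup (Hn n) G" "\<And>n. closed (Hn n)"
    and H: "subgroup H G" "compact H"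
    and avoid: "\<And>C. compact C \<Longrightarrow> C \<inter> H = {} \<Longrightarrow> \<forall>\<^sub>F n in sequentially. C \<inter> Hn n = {}"
    and hit: "\<And>A. open A \<Longrightarrow> A \<inter> H \<noteq> {} \<Longrightarrow> \<forall>\<^sub>F n in sequentially. Hn n \<inter> A \<noteq> {}"
    and M: "\<And>n. invariant_on G (Hn n) (M n)" "invariant_on G H M0"
    and f: "f \<in> Cc" "\<And>n. (\<integral>s. f s \<partial>M n) = 1" "(\<integral>s. f s \<partial>M0) = 1"
    and V: "open V" "H \<subseteq> V" and \<delta>: "\<delta> > 0"
  shows "\<forall>\<^sub>F n in sequentially.
    \<exists>L. compact L \<and> L \<subseteq> Hn n \<and> L \<subseteq> V \<and> measure M0 H \<le> (1 + \<delta>) * measure (M n) L"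
proof -
  define c where "c = measure M0 H"
  \<comment> \<open>The comparison costs \<open>2 * e * c\<close> times the mass of
    \<open>L\<close>, and this factor is at most \<open>\<delta>\<close>; the \<open>+ 1\<close>
    keeps the denominator positive while only \<open>c \<ge> 0\<close> is known.\<close>
  define e where "e = \<delta> / (2 * (c + 1))"
  have c: "c \<ge> 0" unfolding c_def by simp
  have e: "e > 0" "2 * e * c \<le> \<delta>" using c \<delta> by (auto simp: e_def field_simps)
  obtain D where D: "compact D" "\<And>s. s \<notin> D \<Longrightarrow> f s = 0" using Cc_support[OF f(1)] by blast
  obtain V1 where V1: "open V1" "H \<subseteq> V1" "compact (closure V1)" "closure V1 \<subseteq> V"
    using compact_between[OF locally_compact_group H(2) V] .
  \<comment> \<open>The arguments \<open>inv u \<otimes> l\<close> with \<open>u\<close> in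
    \<open>H\<close> and \<open>l\<close> near \<open>H\<close> lie in the compact set
    \<open>D1\<close>. There \<open>f\<close> changes by less than \<open>e\<close> under left
    factors from the inverse of \<open>N1\<close> and under right factors from
    \<open>N2\<close>.\<close>
  define D1 where "D1 = (\<lambda>s. inv s) ` H <#> closure V1"
  have D1: "compact D1" unfolding D1_def by (intro compact_set_mult compact_inv_image H V1)
  have D1I: "inv u \<otimes> l \<in> D1" if "u \<in> H" "l \<in> closure V1" for u l
    using that unfolding D1_def set_mult_def by blast
  note cont = continuous_on_compose2[OF Cc_continuous[OF f(1)]]
  have c1: "continuous_on UNIV (\<lambda>(p, v). f (inv v \<otimes> p) - f p)"
    and c2: "continuous_on UNIV (\<lambda>(p, v). f (p \<otimes> v) - f p)"
    unfolding split_beta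
    by (intro continuous_on_diff cont continuous_on_group_mult continuous_on_group_inv continuous_on_fst
        continuous_on_snd continuous_on_id subset_UNIV)+
  obtain N1 where N1: "open N1" "\<one> \<in> N1" "\<And>p v. p \<in> D1 \<Longrightarrow> v \<in> N1 \<Longrightarrow> \<bar>f (inv v \<otimes> p) - f p\<bar> < e"
    by (rule uniform_near_compact[OF c1 D1 _ e(1), of \<one>]) simp_all
  obtain N2 where N2: "open N2" "\<one> \<in> N2" "\<And>p v. p \<in> D1 \<Longrightarrow> v \<in> N2 \<Longrightarrow> \<bar>f (p \<otimes> v) - f p\<bar> < e"
    by (rule uniform_near_compact[OF c2 D1 _ e(1), of \<one>]) simp_all
  \<comment> \<open>\<open>P\<close> is chosen so that two points which are both
    \<open>P\<close>-close to the same net point differ by an element of \<open>N1\<close>.\<close>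
  have oN: "open ((\<lambda>(a, b). inv a \<otimes> b) -` N1)"
    by (rule open_vimage[OF N1(1)]) (unfold split_beta, intro continuous_intros)
  obtain P1 P2 where P12: "open P1" "open P2" "{\<one>} \<subseteq> P1" "{\<one>} \<subseteq> P2" "P1 \<times> P2 \<subseteq> (\<lambda>(a, b). inv a \<otimes> b) -` N1"
    by (rule tube_compact_compact[of "{\<one>}" "{\<one>}", OF _ _ oN]) (use N1(2) in simp_all)
  define P where "P = P1 \<inter> P2"
  have P: "open P" "\<one> \<in> P" "\<And>a b. a \<in> P \<Longrightarrow> b \<in> P \<Longrightarrow> inv a \<otimes> b \<in> N1"
    using P12 by (auto simp: P_def)
  \<comment> \<open>Every point of \<open>V2\<close> is an element of \<open>H\<close> times an
    element of \<open>N2\<close>, as replacing \<open>l\<close> by \<open>\<sigma>\<close>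
    requires.\<close>
  define V2 where "V2 = V1 \<inter> (\<Union>\<sigma>\<in>H. {s. inv \<sigma> \<otimes> s \<in> N2})"
  have V2: "open V2" "H \<subseteq> V2" "V2 \<subseteq> closure V1"
    using V1(1,2) N2(1,2) closure_subset[of V1]
    by (auto simp: V2_def intro!: open_Int open_UN open_translate bexI)
  \<comment> \<open>\<open>Z\<close> gathers the support of \<open>f\<close>, the closure of
    \<open>V1\<close>, and the products and quotients of its points. As \<open>Z - V2\<close> is
    compact and misses \<open>H\<close>, it eventually misses \<open>Hn n\<close>.\<close>
  define Z where "Z = D \<union> closure V1 \<union> (closure V1 <#> closure V1) \<union> ((\<lambda>s. inv s) ` closure V1 <#> closure V1)"
  have Z: "compact (Z - V2)" unfolding Z_def
    by (intro compact_diff compact_Un D V1 compact_set_mult compact_inv_image V2)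
  have ev1: "\<forall>\<^sub>F n in sequentially. (Z - V2) \<inter> Hn n = {}" using V2 by (intro avoid Z) auto
  \<comment> \<open>\<open>F\<close> is a finite net in \<open>H\<close> at scale \<open>P\<close>;
    hitting finitely many open sets puts points of \<open>Hn n\<close> close to all elements of
    \<open>H\<close> at once.\<close>
  have cov: "H \<subseteq> (\<Union>u\<in>H. {s. inv u \<otimes> s \<in> P})" using P(2) by auto
  obtain F where F: "F \<subseteq> H" "finite F" "H \<subseteq> (\<Union>u\<in>F. {s. inv u \<otimes> s \<in> P})"
    by (rule compactE_image[OF H(2) open_translate[OF P(1)] cov])
  have ev2: "\<forall>\<^sub>F n in sequentially. \<forall>u\<in>F. Hn n \<inter> ({s. inv u \<otimes> s \<in> P} \<inter> V2) \<noteq> {}"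
  proof (rule eventually_ball_finite[OF F(2)], rule ballI, rule hit)
    fix u assume u: "u \<in> F"
    show "open ({s. inv u \<otimes> s \<in> P} \<inter> V2)" by (intro open_Int open_translate P V2)
    show "{s. inv u \<otimes> s \<in> P} \<inter> V2 \<inter> H \<noteq> {}"
    proof -
      have "u \<in> {s. inv u \<otimes> s \<in> P} \<inter> V2 \<inter> H" using u F(1) V2(2) P(2) by auto
      then show ?thesis by blast
    qed
  qed
  \<comment> \<open>\<open>u \<mapsto> u\<inverse>\<close> preserves the integral of \<open>f\<close> over \<open>H\<close>: compare \<open>H\<close> with itself.\<close>
  have "\<bar>c * 1 - c * (\<integral>u. f (inv u) \<partial>M0)\<bar> \<le> 2 * 0 * c * c"
    using invariant_compare[OF f(1) H(2,1) M(2) H(2,1) M(2), of 0] f(3) unfolding c_def by auto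
  then have inv1: "c * (\<integral>u. f (inv u) \<partial>M0) = c" by simp
  from ev1 ev2 show ?thesis
  proof eventually_elim
    case (elim n)
    \<comment> \<open>An element of \<open>Hn n\<close> that lies in \<open>Z\<close> already lies
      in \<open>V2\<close>. Applied to quotients of points of \<open>L\<close> this makes
      \<open>L\<close> a subgroup; applied to the closure of \<open>V1\<close> it makes
      \<open>L\<close> compact.\<close>
    define L where "L = Hn n \<inter> V2"
    have ZL: "s \<in> L" if "s \<in> Z" "s \<in> Hn n" for s using elim(1) that by (auto simp: L_def)
    have "L = Hn n \<inter> closure V1" using ZL V2(3) by (auto simp: L_def Z_def)
    then have Lc: "compact L" using closed_Int_compact[OF Hn(2) V1(3)] by simp
    have LV: "s \<in> closure V1" "s \<in> Hn n" if "s \<in> L" for s using that V2 by (auto simp: L_def)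
    have one: "\<one> \<in> L" using subgroup.one_closed[OF H(1)] subgroup.one_closed[OF Hn(1)] V2 by (auto simp: L_def)
    have div: "inv s \<otimes> t \<in> L" if "s \<in> L" "t \<in> L" for s t
    proof (rule ZL)
      show "inv s \<otimes> t \<in> Z" using LV that unfolding Z_def set_mult_def by blast
      show "inv s \<otimes> t \<in> Hn n"
        using LV that by (intro subgroup.m_closed[OF Hn(1)] subgroup.m_inv_closed[OF Hn(1)])
    qed
    have Ls: "subgroup L G"
    proof (rule subgroupI)
      show "inv a \<in> L" if "a \<in> L" for a using div[OF that one] by simp
      then show "a \<otimes> b \<in> L" if "a \<in> L" "b \<in> L" for a b using div[of "inv a" b] that by simp
    qed (use one in \<open>auto simp: carrier_UNIV\<close>)
    define N where "N = density (M n) (indicator L)"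
    have sM: "sets (M n) = sets borel" using M(1) unfolding invariant_on_def by auto
    have Lb: "L \<in> sets (M n)" using Lc sM by (simp add: compact_imp_closed)
    have N: "invariant_on G L N" unfolding N_def
      by (rule invariant_on_restrict[OF M(1) _ Ls]) (use Lc LV in \<open>auto simp: compact_imp_closed\<close>)
    have NL: "measure N L = measure (M n) L"
      unfolding N_def measure_def using emeasure_restricted[OF Lb Lb] by simp
    have fb: "f \<in> borel_measurable borel" using Cc_borel_measurable[OF f(1)] .
    have fM: "f \<in> borel_measurable (M n)" using fb measurable_cong_sets[OF sM refl] by blast
    \<comment> \<open>Off \<open>D\<close> the function \<open>f\<close> vanishes, and the points of
      \<open>Hn n\<close> in \<open>D\<close> lie in \<open>L\<close>, so restricting to
      \<open>L\<close> loses nothing of the integral.\<close>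
    have "(\<integral>s. f s \<partial>N) = (\<integral>s. indicator L s *\<^sub>R f s \<partial>M n)"
      unfolding N_def
      by (subst integral_density[symmetric]) (use Lb fM in \<open>auto simp: ennreal_indicator\<close>)
    also have "\<dots> = (\<integral>s. f s \<partial>M n)"
    proof (rule integral_cong_AE)
      show "AE s in M n. indicator L s *\<^sub>R f s = f s"
        using invariant_on_AE[OF M(1) Hn(2)]
      proof eventually_elim
        case (elim s)
        then show ?case using D(2)[of s] ZL[of s] by (cases "s \<in> D") (auto simp: Z_def indicator_def)
      qed
    qed (use Lb fM in auto)
    finally have fN: "(\<integral>s. f s \<partial>N) = 1" using f(2) by simp
    have near1: "\<exists>l'\<in>L. \<forall>l\<in>L. \<bar>f (inv u \<otimes> l) - f (inv l' \<otimes> l)\<bar> \<le> e" if u: "u \<in> H" for u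
    proof -
      obtain u' where u': "u' \<in> F" "inv u' \<otimes> u \<in> P" using F(3) u by blast
      obtain l' where l': "l' \<in> L" "inv u' \<otimes> l' \<in> P" using elim(2) u'(1) by (auto simp: L_def)
      \<comment> \<open>Passing from \<open>inv u\<close> to \<open>inv l'\<close> multiplies the
        argument of \<open>f\<close> on the left by \<open>inv v\<close>, and \<open>v\<close> lies
        in \<open>N1\<close> because \<open>u\<close> and \<open>l'\<close> are close to the same
        net point \<open>u'\<close>.\<close>
      define v where "v = inv u \<otimes> l'"
      have "inv (inv u' \<otimes> u) \<otimes> (inv u' \<otimes> l') = v" by (simp add: v_def inv_mult_group m_assoc)
      then have v: "v \<in> N1" using P(3)[OF u'(2) l'(2)] by simp
      have "\<bar>f (inv u \<otimes> l) - f (inv l' \<otimes> l)\<bar> \<le> e" if l: "l \<in> L" for l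
      proof -
        have "inv v \<otimes> (inv u \<otimes> l) = inv l' \<otimes> l" by (simp add: v_def inv_mult_group m_assoc)
        then show ?thesis using N1(3)[OF D1I[OF u LV(1)[OF l]] v] by simp
      qed
      then show ?thesis using l'(1) by blast
    qed
    have near2: "\<exists>\<sigma>\<in>H. \<forall>u\<in>H. \<bar>f (inv u \<otimes> l) - f (inv u \<otimes> \<sigma>)\<bar> \<le> e" if l: "l \<in> L" for l
    proof -
      obtain \<sigma> where \<sigma>: "\<sigma> \<in> H" "inv \<sigma> \<otimes> l \<in> N2" using l by (auto simp: L_def V2_def)
      have "\<bar>f (inv u \<otimes> l) - f (inv u \<otimes> \<sigma>)\<bar> \<le> e" if u: "u \<in> H" for u
      proof -
        have "\<sigma> \<in> closure V1" using \<sigma>(1) V2 by blast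
        from N2(3)[OF D1I[OF u this] \<sigma>(2)] show ?thesis by (simp add: m_assoc)
      qed
      then show ?thesis using \<sigma>(1) by blast
    qed
    have "\<bar>c * 1 - measure N L * (\<integral>u. f (inv u) \<partial>M0)\<bar> \<le> 2 * e * c * measure N L"
      using invariant_compare[OF f(1) H(2,1) M(2) Lc Ls N near1 near2] unfolding fN c_def .
    moreover have "c \<le> (1 + \<delta>) * measure N L" if "\<bar>c - measure N L * a\<bar> \<le> 2 * e * c * measure N L" "c * a = c" for a
    proof (cases "c = 0")
      case False
      then have "a = 1" using that(2) by simp
      then have "c \<le> measure N L + 2 * e * c * measure N L" using that(1) by (simp add: abs_le_iff)
      also have "\<dots> \<le> measure N L + \<delta> * measure N L" using e(2) by (simp add: mult_right_mono)
      finally show ?thesis by (simp add: algebra_simps)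
    qed (use \<delta> in simp)
    ultimately have "c \<le> (1 + \<delta>) * measure (M n) L" using inv1 NL by simp
    then show ?case using Lc LV V1(4) unfolding c_def by blast
  qed
qed

subsection \<open>Integration over quotients\<close>

lemma mem_coset_map: "t \<in> coset_map G H s \<longleftrightarrow> inv s \<otimes> t \<in> H"
  unfolding coset_map_def l_coset_def by (auto intro!: bexI[of _ "inv s \<otimes> t"])

lemma coset_map_eq_iff:
  assumes "subgroup H G"
  shows "coset_map G H s = coset_map G H t \<longleftrightarrow> inv s \<otimes> t \<in> H"
proof
  assume "coset_map G H s = coset_map G H t"
  moreover have "t \<in> coset_map G H t"
    using subgroup.one_closed[OF assms] by (simp add: mem_coset_map)
  ultimately show "inv s \<otimes> t \<in> H" by (simp flip: mem_coset_map)
next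
  assume st: "inv s \<otimes> t \<in> H"
  have ts: "inv t \<otimes> s \<in> H"
    using subgroup.m_inv_closed[OF assms st] by (simp add: inv_mult_group)
  have "s \<otimes> h = t \<otimes> ((inv t \<otimes> s) \<otimes> h)" "t \<otimes> h = s \<otimes> ((inv s \<otimes> t) \<otimes> h)" for h
    by (simp_all add: m_assoc)
  then show "coset_map G H s = coset_map G H t"
    using subgroup.m_closed[OF assms st] subgroup.m_closed[OF assms ts]
    unfolding coset_map_def l_coset_def by blast
qed

lemma coset_map_mult: "subgroup H G \<Longrightarrow> t \<in> H \<Longrightarrow> coset_map G H (s \<otimes> t) = coset_map G H s"
  by (metis coset_map_eq_iff mult_inv_cancel(2))

text \<open>\<open>B <#> H\<close> is the saturation of \<open>B\<close> under the quotient map;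
  through it closedness in the quotient becomes closedness in \<open>G\<close>.\<close>

lemma mem_set_mult_iff:
  assumes "subgroup H G"
  shows "s \<in> B <#> H \<longleftrightarrow> coset_map G H s \<in> coset_map G H ` B"
proof -
  have "s \<in> B <#> H \<longleftrightarrow> (\<exists>b\<in>B. inv b \<otimes> s \<in> H)"
    unfolding set_mult_def by (force intro: bexI[of _ "inv b \<otimes> s" for b])
  then show ?thesis by (metis (mono_tags) assms coset_map_eq_iff image_iff)
qed

lemma openin_coset_topology:
  "openin (coset_topology G H) U \<longleftrightarrow> U \<subseteq> range (coset_map G H) \<and> open {s. coset_map G H s \<in> U}"
  unfolding coset_topology_def openin_quotient_topology by simp

lemma topspace_coset_topology: "topspace (coset_topology G H) = range (coset_map G H)"
  unfolding coset_topology_def topspace_quotient_topology by simp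

lemma closedin_coset_image:
  assumes "subgroup H G" "closed (B <#> H)"
  shows "closedin (coset_topology G H) (coset_map G H ` B)"
  unfolding closedin_def topspace_coset_topology openin_coset_topology
proof (intro conjI)
  have "{s. coset_map G H s \<in> range (coset_map G H) - coset_map G H ` B} = - (B <#> H)"
    using mem_set_mult_iff[OF assms(1), of _ B] by auto
  then show "open {s. coset_map G H s \<in> range (coset_map G H) - coset_map G H ` B}"
    using assms(2) by (simp add: open_Compl)
qed auto

lemma compactin_coset_image: "compact A \<Longrightarrow> compactin (coset_topology G H) (coset_map G H ` A)"
  by (rule image_compactin[of euclidean])
    (simp_all add: coset_topology_def quotient_imp_continuous_map[OF quotient_map_quotient_topology])

lemma radon_closedin_sets:
  assumes "radon_measure T N" "closedin T S"
  shows "S \<in> sets N"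
proof -
  have "topspace T - S \<in> sigma_sets (topspace T) {U. openin T U}"
    using assms(2) by (intro sigma_sets.Basic) (simp add: openin_diff)
  then have "topspace T - (topspace T - S) \<in> sigma_sets (topspace T) {U. openin T U}"
    by (rule sigma_sets.Compl)
  then show ?thesis
    using assms closedin_subset[OF assms(2)] unfolding radon_measure_def by (simp add: double_diff)
qed

lemma invariant_on_integrable:
  fixes h :: "'g \<Rightarrow> real"
  assumes M: "invariant_on G H M" and h: "h \<in> Cc"
  shows "integrable M (\<lambda>t. h (s \<otimes> t))"
proof -
  obtain D where D: "compact D" "\<And>s. s \<notin> D \<Longrightarrow> h s = 0" using Cc_support[OF h] by blast
  obtain B where B: "\<And>s. \<bar>h s\<bar> \<le> B" using Cc_bounded[OF h] by blast
  define K where "K = {inv s} <#> D"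
  have K: "compact K" unfolding K_def by (intro compact_set_mult D) simp
  have sM: "sets M = sets borel" and fin: "emeasure M K < \<infinity>" using M K unfolding invariant_on_def by auto
  have KM: "K \<in> sets M" using K sM by (simp add: compact_imp_closed)
  have hK: "h (s \<otimes> t) = 0" if "t \<notin> K" for t
  proof -
    have "inv s \<otimes> (s \<otimes> t) \<notin> K" using that by simp
    then have "s \<otimes> t \<notin> D" unfolding K_def set_mult_def by blast
    then show ?thesis by (rule D(2))
  qed
  have "(\<lambda>t. h (s \<otimes> t)) \<in> borel_measurable borel"
    by (intro borel_measurable_continuous_onI continuous_on_compose2[OF Cc_continuous[OF h]]
        continuous_intros subset_UNIV)
  then have meas: "(\<lambda>t. h (s \<otimes> t)) \<in> borel_measurable M" using measurable_cong_sets[OF sM refl] by blast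
  have bd: "norm (h (s \<otimes> t)) \<le> norm (B * indicator K t)" for t
    using B[of "s \<otimes> t"] hK[of t] by (cases "t \<in> K") auto
  show ?thesis
    by (rule Bochner_Integration.integrable_bound[OF _ meas AE_I2[OF bd]]) (use KM fin in simp)
qed

text \<open>Dominated convergence along a sequence. While \<open>u n\<close> stays in a relatively
  compact neighbourhood of \<open>s\<close>, all integrands vanish off one compact set
  \<open>K\<close>; the shift by \<open>n0\<close> discards the earlier terms.\<close>

lemma fibre_integral_continuous:
  fixes h :: "'g \<Rightarrow> real"
  assumes M: "invariant_on G H M" and h: "h \<in> Cc"
  shows "continuous_on UNIV (\<lambda>s. \<integral>t. h (s \<otimes> t) \<partial>M)"
proof (rule continuous_on_sequentiallyI)
  fix u :: "nat \<Rightarrow> 'g" and s assume u: "u \<longlonglongrightarrow> s"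
  obtain D where D: "compact D" "\<And>s. s \<notin> D \<Longrightarrow> h s = 0" using Cc_support[OF h] by blast
  obtain B where B: "\<And>s. \<bar>h s\<bar> \<le> B" using Cc_bounded[OF h] by blast
  obtain U where U: "open U" "{s} \<subseteq> U" "compact (closure U)"
    by (rule compact_between[OF locally_compact_group, of "{s}" UNIV]) auto
  define K where "K = (\<lambda>s. inv s) ` closure U <#> D"
  have K: "compact K" unfolding K_def by (intro compact_set_mult compact_inv_image U D)
  have sM: "sets M = sets borel" and fin: "emeasure M K < \<infinity>" using M K unfolding invariant_on_def by auto
  have KM: "K \<in> sets M" using K sM by (simp add: compact_imp_closed)
  have "\<forall>\<^sub>F n in sequentially. u n \<in> U" using topological_tendstoD[OF u U(1)] U(2) by simp
  then obtain n0 where n0: "\<And>n. n \<ge> n0 \<Longrightarrow> u n \<in> U" unfolding eventually_sequentially by blast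
  have hK: "h (v \<otimes> t) = 0" if "t \<notin> K" "v \<in> U" for t v
  proof -
    have "inv v \<otimes> (v \<otimes> t) \<notin> K" using that by simp
    moreover have "v \<in> closure U" using that(2) closure_subset by blast
    ultimately have "v \<otimes> t \<notin> D" unfolding K_def set_mult_def by blast
    then show ?thesis by (rule D(2))
  qed
  have "(\<lambda>n. \<integral>t. h (u (n + n0) \<otimes> t) \<partial>M) \<longlonglongrightarrow> (\<integral>t. h (s \<otimes> t) \<partial>M)"
  proof (rule integral_dominated_convergence[where w = "\<lambda>t. B * indicator K t"])
    show "integrable M (\<lambda>t. B * indicator K t)" using KM fin by simp
    show "AE t in M. (\<lambda>n. h (u (n + n0) \<otimes> t)) \<longlonglongrightarrow> h (s \<otimes> t)"
    proof (rule AE_I2)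
      fix t
      have "isCont h (s \<otimes> t)" by (rule continuous_on_interior[OF Cc_continuous[OF h]]) simp
      moreover have "(\<lambda>n. u (n + n0) \<otimes> t) \<longlonglongrightarrow> s \<otimes> t"
        by (rule tendsto_group_mult[OF LIMSEQ_ignore_initial_segment[OF u] tendsto_const])
      ultimately show "(\<lambda>n. h (u (n + n0) \<otimes> t)) \<longlonglongrightarrow> h (s \<otimes> t)" by (rule isCont_tendsto_compose)
    qed
    show "AE t in M. norm (h (u (n + n0) \<otimes> t)) \<le> B * indicator K t" for n
    proof (rule AE_I2)
      fix t
      show "norm (h (u (n + n0) \<otimes> t)) \<le> B * indicator K t"
        using B[of "u (n + n0) \<otimes> t"] hK[of t "u (n + n0)"] n0[of "n + n0"] by (cases "t \<in> K") simp_all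
    qed
  qed (use invariant_on_integrable[OF M h] in simp_all)
  then show "(\<lambda>n. \<integral>t. h (u n \<otimes> t) \<partial>M) \<longlonglongrightarrow> (\<integral>t. h (s \<otimes> t) \<partial>M)"
    by (rule LIMSEQ_offset)
qed

text \<open>The identity defining the quotient measure is one between complex Bochner integrals. It
  is turned into one for a nonnegative integral over the quotient, in which pointwise bounds on the
  fibre integrals can be integrated.\<close>

lemma quotient_integral:
  fixes h :: "'g \<Rightarrow> real"
  assumes H: "subgroup H G" "closed H"
    and m: "left_haar_measure (G\<lparr>carrier := H\<rparr>) (top_of_set H) m"
    and N: "compatible_quotient_haar G \<mu> m H N"
    and h: "h \<in> Cc" "\<And>s. h s \<ge> 0"
  defines "F \<equiv> \<lambda>s. \<integral>t. h (s \<otimes> t) \<partial>distr m borel (\<lambda>t. t)"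
  obtains P where "\<And>s. P (coset_map G H s) = F s" "P \<in> borel_measurable N" "\<And>C. P C \<ge> 0"
    "space N = range (coset_map G H)"
    "ennreal (\<integral>s. h s \<partial>\<mu>) = (\<integral>\<^sup>+C. ennreal (P C) \<partial>N)"
proof -
  let ?q = "coset_map G H"
  define M where "M = distr m borel (\<lambda>t. t)"
  have idm: "(\<lambda>t. t) \<in> m \<rightarrow>\<^sub>M borel" and M: "invariant_on G H M"
    using haar_invariant_on[OF m H(2,1)] unfolding M_def by auto
  have hb: "(\<lambda>t. h (s \<otimes> t)) \<in> borel_measurable borel" for s
    by (intro borel_measurable_continuous_onI continuous_on_compose2[OF Cc_continuous[OF h(1)]]
        continuous_intros subset_UNIV)
  \<comment> \<open>The representative is the one chosen in \<open>compatible_quotient_haar\<close>;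
    invariance of \<open>M\<close> shows below that the value does not depend on it.\<close>
  define P where "P C = F (SOME s. s \<in> C)" for C
  have Finv: "F (s \<otimes> u) = F s" if "u \<in> H" for s u
    unfolding F_def M_def[symmetric] using invariant_on_integral[OF M that hb[of s]] by (simp add: m_assoc)
  have P: "P (?q s) = F s" for s
  proof -
    have "s \<in> ?q s" using subgroup.one_closed[OF H(1)] by (simp add: mem_coset_map)
    then have "(SOME s'. s' \<in> ?q s) \<in> ?q s" by (rule someI)
    then have "inv s \<otimes> (SOME s'. s' \<in> ?q s) \<in> H" by (simp add: mem_coset_map)
    from Finv[OF this, of s] show ?thesis by (simp add: P_def)
  qed
  have rN: "radon_measure (coset_topology G H) N"
    using N unfolding compatible_quotient_haar_def right_haar_measure_def by blast
  have sp: "space N = range ?q" and se: "sets N = sigma_sets (range ?q) {U. openin (coset_topology G H) U}"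
    and fin: "\<And>K. compactin (coset_topology G H) K \<Longrightarrow> emeasure N K < \<infinity>"
    using rN unfolding radon_measure_def topspace_coset_topology by auto
  have Fc: "continuous_on UNIV F"
    unfolding F_def M_def[symmetric] by (rule fibre_integral_continuous[OF M h(1)])
  have meas: "P \<in> borel_measurable N"
  proof (rule borel_measurableI)
    fix S :: "real set" assume "open S"
    have "{s. ?q s \<in> P -` S \<inter> range ?q} = F -` S" using P by auto
    then have "openin (coset_topology G H) (P -` S \<inter> range ?q)"
      unfolding openin_coset_topology using open_vimage[OF \<open>open S\<close> Fc] by simp
    then show "P -` S \<inter> space N \<in> sets N" unfolding sp se by (auto intro: sigma_sets.Basic)
  qed
  have F0: "F s \<ge> 0" for s unfolding F_def by (intro Bochner_Integration.integral_nonneg h(2))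
  then have P0: "P C \<ge> 0" for C by (simp add: P_def)
  obtain D where D: "compact D" "\<And>s. s \<notin> D \<Longrightarrow> h s = 0" using Cc_support[OF h(1)] by blast
  have Fz: "F s = 0" if "?q s \<notin> ?q ` D" for s
  proof -
    have "h (s \<otimes> t) = 0" if "t \<in> H" for t
      using D(2)[of "s \<otimes> t"] coset_map_mult[OF H(1) that, of s] \<open>?q s \<notin> ?q ` D\<close> by (metis image_eqI)
    then have "AE t in M. h (s \<otimes> t) = 0"
      using invariant_on_AE[OF M H(2)] by (auto elim: eventually_mono)
    then show ?thesis unfolding F_def M_def[symmetric] by (rule integral_eq_zero_AE)
  qed
  have "bounded (F ` D)"
    by (intro compact_imp_bounded compact_continuous_image D continuous_on_subset[OF Fc]) simp
  then obtain B where B: "\<And>s. s \<in> D \<Longrightarrow> \<bar>F s\<bar> \<le> B" unfolding bounded_iff by auto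
  have qD: "?q ` D \<in> sets N" "emeasure N (?q ` D) < \<infinity>"
    using radon_closedin_sets[OF rN closedin_coset_image[OF H(1) closed_set_mult[OF D(1) H(2)]]]
      fin[OF compactin_coset_image[OF D(1)]] by auto
  \<comment> \<open>\<open>P\<close> is bounded and vanishes off the compact image of
    \<open>D\<close>. Integrability matters because a Bochner integral is 0 by default on
    non-integrable functions and would then say nothing about the nonnegative integral.\<close>
  have int: "integrable N P"
  proof (rule Bochner_Integration.integrable_bound[OF _ meas AE_I2])
    show "integrable N (\<lambda>C. B * indicator (?q ` D) C)" using qD by simp
    fix C assume "C \<in> space N"
    then obtain s where s: "C = ?q s" unfolding sp by blast
    show "norm (P C) \<le> norm (B * indicator (?q ` D) C)"
    proof (cases "C \<in> ?q ` D")
      case True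
      then obtain d where "d \<in> D" "C = ?q d" by blast
      then show ?thesis using B[of d] True P[of d] by (simp add: abs_le_iff)
    next
      case False
      then show ?thesis using Fz[of s] P[of s] s by simp
    qed
  qed
  have "(\<lambda>s. complex_of_real (h s)) \<in> Cc"
    using h(1) unfolding Cc_def by (auto intro!: continuous_intros)
  then have "(\<integral>s. complex_of_real (h s) \<partial>\<mu>)
      = (\<integral>C. (\<integral>t. complex_of_real (h ((SOME s. s \<in> C) \<otimes> t)) \<partial>m) \<partial>N)"
    using N unfolding compatible_quotient_haar_def by blast
  moreover have "(\<integral>t. h (s \<otimes> t) \<partial>m) = F s" for s
    unfolding F_def using integral_distr[OF idm hb] by simp
  ultimately have "(\<integral>s. h s \<partial>\<mu>) = (\<integral>C. P C \<partial>N)"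
    unfolding integral_complex_of_real P_def by (simp only: of_real_eq_iff)
  then have "ennreal (\<integral>s. h s \<partial>\<mu>) = (\<integral>\<^sup>+C. ennreal (P C) \<partial>N)"
    using nn_integral_eq_integral[OF int] P0 by simp
  then show ?thesis by (rule that[OF P meas P0 sp])
qed

section \<open>Upper semicontinuity of the quotient measures\<close>

text \<open>With \<open>c\<close> the mass of \<open>H\<close> and \<open>l\<close> that of the
  piece \<open>L\<close> of \<open>Hn n\<close>, the integral of \<open>h\<close> over
  \<open>\<mu>\<close> is at most \<open>c * r\<close> and at least \<open>l\<close> times the mass
  of the image of \<open>B\<close>, while \<open>c * r \<le> l * r2\<close> and
  \<open>ennreal r2 < b\<close>.\<close>

lemma quotient_measure_usc:
  fixes H :: "'g set" and f :: "'g \<Rightarrow> real" and b :: ennreal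
  assumes Hn: "\<And>n. subgroup (Hn n) G" "\<And>n. closed (Hn n)"
    and H: "subgroup H G" "compact H"
    and avoid: "\<And>C. compact C \<Longrightarrow> C \<inter> H = {} \<Longrightarrow> \<forall>\<^sub>F n in sequentially. C \<inter> Hn n = {}"
    and hit: "\<And>A. open A \<Longrightarrow> A \<inter> H \<noteq> {} \<Longrightarrow> \<forall>\<^sub>F n in sequentially. Hn n \<inter> A \<noteq> {}"
    and m: "\<And>n. left_haar_measure (G\<lparr>carrier := Hn n\<rparr>) (top_of_set (Hn n)) (m n)"
      "left_haar_measure (G\<lparr>carrier := H\<rparr>) (top_of_set H) m0"
    and f: "f \<in> Cc" "\<And>n. (\<integral>s. f s \<partial>m n) = 1" "(\<integral>s. f s \<partial>m0) = 1"
    and N: "\<And>n. compatible_quotient_haar G \<mu> (m n) (Hn n) (N n)"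
      "compatible_quotient_haar G \<mu> m0 H N0"
    and A: "compact A" and b: "emeasure N0 (coset_map G H ` A) < b"
  obtains U where "open U" "A \<subseteq> U"
    "\<forall>\<^sub>F n in sequentially. \<forall>B\<subseteq>U. emeasure (N n) (coset_map G (Hn n) ` B) \<le> b"
proof -
  have clH: "closed H" using H(2) by (rule compact_imp_closed)
  \<comment> \<open>The gap below \<open>b\<close> is used twice: \<open>b1\<close> leaves room for
    an open \<open>Q\<close> around the image of \<open>A\<close>, and \<open>b2\<close> for the
    factor \<open>1 + \<delta>\<close>. Both are finite even if \<open>b\<close> is not.\<close>
  obtain b1 where b1: "emeasure N0 (coset_map G H ` A) < b1" "b1 < b" using dense[OF b] by blast
  obtain b2 where b2: "b1 < b2" "b2 < b" using dense[OF b1(2)] by blast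
  obtain r where r: "b1 = ennreal r" "r \<ge> 0" using b2(1) by (cases b1) auto
  obtain r2 where r2: "b2 = ennreal r2" "r2 \<ge> 0" using b2(2) by (cases b2) auto
  have "0 < r" using b1(1) r by (metis ennreal_neg not_less order_less_le_trans zero_le linorder_not_less)
  have "r < r2" using b2(1) r r2 by (simp add: ennreal_less_iff)
  define \<delta> where "\<delta> = r2 / r - 1"
  have \<delta>: "\<delta> > 0" "(1 + \<delta>) * r = r2" using \<open>0 < r\<close> \<open>r < r2\<close> by (auto simp: \<delta>_def field_simps)
  have radon: "radon_measure (coset_topology G H) N0"
    using N(2) unfolding compatible_quotient_haar_def right_haar_measure_def by blast
  have qA: "coset_map G H ` A \<in> sets N0"
    by (rule radon_closedin_sets[OF radon closedin_coset_image[OF H(1) closed_set_mult[OF A clH]]])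
  then have "emeasure N0 (coset_map G H ` A)
      = (INF U\<in>{U. openin (coset_topology G H) U \<and> coset_map G H ` A \<subseteq> U}. emeasure N0 U)"
    using radon unfolding radon_measure_def by blast
  then obtain Q where Q: "openin (coset_topology G H) Q" "coset_map G H ` A \<subseteq> Q" "emeasure N0 Q < b1"
    using b1(1) by (auto simp: INF_less_iff)
  define Q' where "Q' = {s. coset_map G H s \<in> Q}"
  have Q': "open Q'" using Q(1) unfolding Q'_def openin_coset_topology by blast
  have QN: "Q \<in> sets N0"
    using radon Q(1) openin_subset[OF Q(1)] unfolding radon_measure_def by (auto intro: sigma_sets.Basic)
  have AH: "A <#> H \<subseteq> Q'"
    using Q(2) coset_map_mult[OF H(1)] unfolding set_mult_def Q'_def by fastforce
  obtain h U1 where h: "h \<in> Cc" "\<And>s. 0 \<le> h s \<and> h s \<le> (1::real)" and U1: "open U1" "A <#> H \<subseteq> U1"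
    "\<And>s. s \<in> U1 \<Longrightarrow> h s = 1" "\<And>s. s \<notin> Q' \<Longrightarrow> h s = 0"
    by (rule Urysohn_Cc[OF locally_compact_group compact_set_mult[OF A H(2)] Q' AH]) blast
  \<comment> \<open>Products from \<open>U \<times> V\<close> lie in \<open>U1\<close>, where
    \<open>h\<close> is 1; so for \<open>s\<close> in \<open>U\<close> the fibre integral over
    \<open>Hn n\<close> is at least the mass of any compact \<open>L \<subseteq> V\<close>.\<close>
  have oU1: "open ((\<lambda>(s, t). s \<otimes> t) -` U1)" by (rule open_vimage[OF U1(1) continuous_mult])
  have sub: "A \<times> H \<subseteq> (\<lambda>(s, t). s \<otimes> t) -` U1" 
    using subsetD[OF U1(2) set_multI] by auto
  obtain U V where UV: "open U" "open V" "A \<subseteq> U" "H \<subseteq> V" "U \<times> V \<subseteq> (\<lambda>(s, t). s \<otimes> t) -` U1"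
    by (rule tube_compact_compact[OF A H(2) oU1 sub])
  define M where "M n = distr (m n) borel (\<lambda>t. t)" for n
  define M0 where "M0 = distr m0 borel (\<lambda>t. t)"
  note invn = haar_invariant_on[OF m(1) Hn(2,1)] and inv0 = haar_invariant_on[OF m(2) clH H(1)]
  have M: "\<And>n. invariant_on G (Hn n) (M n)" "invariant_on G H M0"
    unfolding M_def M0_def by (rule invn(2), rule inv0(2))
  have fb: "f \<in> borel_measurable borel" by (rule Cc_borel_measurable[OF f(1)])
  have fM: "\<And>n. (\<integral>s. f s \<partial>M n) = 1" "(\<integral>s. f s \<partial>M0) = 1"
    unfolding M_def M0_def using integral_distr[OF invn(1) fb] integral_distr[OF inv0(1) fb] f by auto
  define c where "c = measure M0 H"
  note fin0 = invariant_on_finite[OF M(2) H(2) clH]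
  interpret M0: finite_measure M0 by (rule fin0(1))
  have sp0: "space M0 = UNIV" unfolding M0_def by simp
  have "emeasure M0 UNIV \<noteq> 0"
    using m(2) emeasure_distr[OF inv0(1), of UNIV] unfolding left_haar_measure_def M0_def by simp
  then have c: "c > 0"
    unfolding c_def fin0(2)[symmetric] using M0.emeasure_eq_measure[of UNIV] by (simp add: less_le)
  \<comment> \<open>Both quotient integrals are computed from \<open>\<integral>h d\<mu>\<close>, which does not depend on \<open>n\<close>.\<close>
  have upper: "ennreal (\<integral>s. h s \<partial>\<mu>) \<le> ennreal (c * r)"
  proof -
    obtain P where P: "\<And>s. P (coset_map G H s) = (\<integral>t. h (s \<otimes> t) \<partial>M0)"
        "space N0 = range (coset_map G H)" "ennreal (\<integral>s. h s \<partial>\<mu>) = (\<integral>\<^sup>+C. ennreal (P C) \<partial>N0)"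
      using quotient_integral[OF H(1) clH m(2) N(2) h(1)] h(2) unfolding M0_def by metis
    have "(\<integral>t. h (s \<otimes> t) \<partial>M0) \<le> c" for s
    proof -
      have "(\<integral>t. h (s \<otimes> t) \<partial>M0) \<le> (\<integral>t. 1 \<partial>M0)"
        by (rule integral_mono[OF invariant_on_integrable[OF M(2) h(1)]]) (use h(2) in auto)
      then show ?thesis by (simp add: sp0 fin0(2) c_def)
    qed
    moreover have "(\<integral>t. h (s \<otimes> t) \<partial>M0) = 0" if "coset_map G H s \<notin> Q" for s
    proof (rule integral_eq_zero_AE)
      show "AE t in M0. h (s \<otimes> t) = 0"
        using invariant_on_AE[OF M(2) clH]
      proof eventually_elim
        case (elim t)
        then show ?case using coset_map_mult[OF H(1), of t s] that by (intro U1(4)) (simp add: Q'_def)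
      qed
    qed
    ultimately have "ennreal (P C) \<le> ennreal c * indicator Q C" if "C \<in> space N0" for C
      using that P(1) c unfolding P(2) by (auto simp: indicator_def ennreal_leI)
    then have "(\<integral>\<^sup>+C. ennreal (P C) \<partial>N0) \<le> (\<integral>\<^sup>+C. ennreal c * indicator Q C \<partial>N0)"
      by (rule nn_integral_mono)
    also have "\<dots> = ennreal c * emeasure N0 Q" using QN by (simp add: nn_integral_cmult_indicator)
    also have "\<dots> \<le> ennreal c * ennreal r" using Q(3) r by (intro mult_left_mono) auto
    also have "\<dots> = ennreal (c * r)" using c r by (simp add: ennreal_mult)
    finally show ?thesis using P(3) by simp
  qed
  have "\<forall>\<^sub>F n in sequentially. \<exists>L. compact L \<and> L \<subseteq> Hn n \<and> L \<subseteq> V \<and> c \<le> (1 + \<delta>) * measure (M n) L"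
    unfolding c_def by (rule haar_liminf[OF Hn H avoid hit M f(1) fM UV(2,4) \<delta>(1)])
  then have "\<forall>\<^sub>F n in sequentially. \<forall>B\<subseteq>U. emeasure (N n) (coset_map G (Hn n) ` B) \<le> b"
  proof eventually_elim
    case (elim n)
    then obtain L where L: "compact L" "L \<subseteq> Hn n" "L \<subseteq> V" "c \<le> (1 + \<delta>) * measure (M n) L" by blast
    define l where "l = measure (M n) L"
    have "0 < (1 + \<delta>) * l" using c L(4) unfolding l_def by linarith
    then have l: "l > 0" using \<delta>(1) by (simp add: zero_less_mult_iff)
    have sM: "sets (M n) = sets borel" by (simp add: M_def)
    have finL: "emeasure (M n) L < \<infinity>" using M(1) L(1) unfolding invariant_on_def by blast
    obtain P where P: "\<And>s. P (coset_map G (Hn n) s) = (\<integral>t. h (s \<otimes> t) \<partial>M n)" "\<And>C. P C \<ge> 0"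
        "ennreal (\<integral>s. h s \<partial>\<mu>) = (\<integral>\<^sup>+C. ennreal (P C) \<partial>N n)"
      using quotient_integral[OF Hn m(1) N(1) h(1)] h(2) unfolding M_def by metis
    have lower: "l \<le> (\<integral>t. h (s \<otimes> t) \<partial>M n)" if "s \<in> U" for s
    proof -
      have "(\<integral>t. indicator L t \<partial>M n) \<le> (\<integral>t. h (s \<otimes> t) \<partial>M n)"
      proof (rule integral_mono[OF _ invariant_on_integrable[OF M(1) h(1)]])
        show "integrable (M n) (indicator L :: 'g \<Rightarrow> real)"
          using L(1) finL sM by (simp add: compact_imp_closed)
        show "indicator L t \<le> h (s \<otimes> t)" for t
        proof (cases "t \<in> L")
          case True
          then have "(s, t) \<in> U \<times> V" using that L(3) by blast
          from subsetD[OF UV(5) this] have "s \<otimes> t \<in> U1" by simp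
          then show ?thesis using U1(3) True by simp
        qed (use h(2) in simp)
      qed
      then show ?thesis using L(1) sM sets_eq_imp_space_eq[OF sM] by (simp add: l_def compact_imp_closed)
    qed
    show ?case
    proof (intro allI impI)
      fix B assume B: "B \<subseteq> U"
      let ?B = "coset_map G (Hn n) ` B"
      show "emeasure (N n) ?B \<le> b"
      \<comment> \<open>A non-measurable image has \<open>emeasure\<close> 0 by default, which makes
        the bound immediate for it.\<close>
      proof (cases "?B \<in> sets (N n)")
        case True
        have "ennreal l * emeasure (N n) ?B = (\<integral>\<^sup>+C. ennreal l * indicator ?B C \<partial>N n)"
          using True by (simp add: nn_integral_cmult_indicator)
        also have "\<dots> \<le> (\<integral>\<^sup>+C. ennreal (P C) \<partial>N n)"
          by (rule nn_integral_mono) (use P(1,2) lower B in \<open>auto simp: indicator_def intro!: ennreal_leI\<close>)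
        also have "\<dots> \<le> ennreal (c * r)" using upper P(3) by simp
        also have "\<dots> \<le> ennreal (l * r2)"
        proof (rule ennreal_leI)
          have "c * r \<le> (1 + \<delta>) * l * r" using L(4) r(2) unfolding l_def by (rule mult_right_mono)
          then show "c * r \<le> l * r2" using \<delta>(2) by (simp add: algebra_simps flip: \<delta>(2))
        qed
        also have "\<dots> = ennreal l * b2" using l r2 by (simp add: ennreal_mult)
        finally have "emeasure (N n) ?B \<le> b2" using l by (simp add: ennreal_mult_le_mult_iff)
        then show ?thesis using b2(2) by simp
      qed (simp add: emeasure_notin_sets)
    qed
  qed
  then show ?thesis using that[OF UV(1,3)] by blast
qed

text \<open>Normality makes left and right cosets coincide, so right translation in \<open>G\<close>
  descends to right multiplication in \<open>G Mod H\<close>.\<close>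

lemma coset_map_translate:
  assumes H: "H \<lhd> G"
  shows "coset_map G H ` (\<lambda>a. a \<otimes> s) ` A = (coset_map G H ` A) #>\<^bsub>G Mod H\<^esub> coset_map G H s"
    "coset_map G H s \<in> carrier (G Mod H)"
proof -
  interpret normal H G by fact
  have q: "coset_map G H t = H #> t" for t using coset_eq by (simp add: coset_map_def)
  show "coset_map G H ` (\<lambda>a. a \<otimes> s) ` A = (coset_map G H ` A) #>\<^bsub>G Mod H\<^esub> coset_map G H s"
    unfolding r_coset_def[of "G Mod H"] by (auto simp: q FactGroup_def rcos_sum)
  show "coset_map G H s \<in> carrier (G Mod H)" by (auto simp: q FactGroup_def RCOSETS_def)
qed

lemma quotient_measure_translate:
  assumes "H \<lhd> G" and N: "right_haar_measure (G Mod H) (coset_topology G H) N"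
    and "coset_map G H ` A \<in> sets N"
  shows "emeasure N (coset_map G H ` (\<lambda>a. a \<otimes> s) ` A) = emeasure N (coset_map G H ` A)"
  using N assms(3) coset_map_translate[OF assms(1)] unfolding right_haar_measure_def by metis

text \<open>The members of a countable basis that have compact closure cover \<open>G\<close>. Their
  closures are accumulated one by one; as the members are open, finitely many cover any compact
  set.\<close>

lemma compact_exhaustion:
  obtains K :: "nat \<Rightarrow> 'g set" where "\<And>m. compact (K m)" "\<And>C. compact C \<Longrightarrow> \<exists>m. \<forall>n\<ge>m. C \<subseteq> K n"
proof -
  obtain \<B> :: "'g set set" where \<B>: "countable \<B>" "topological_basis \<B>"
    using ex_countable_basis by blast
  define \<C> where "\<C> = {B \<in> \<B>. compact (closure B)}"
  have cov: "\<exists>B\<in>\<C>. s \<in> B" for s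
  proof -
    obtain U where U: "open U" "{s} \<subseteq> U" "compact (closure U)"
      by (rule compact_between[OF locally_compact_group, of "{s}" UNIV]) auto
    obtain B where B: "B \<in> \<B>" "s \<in> B" "B \<subseteq> U" using topological_basisE[OF \<B>(2) U(1)] U(2) by blast
    have "compact (closure B)"
      using compact_Int_closed[OF U(3), of "closure B"] closure_mono[OF B(3)] by (simp add: inf.absorb2)
    then show ?thesis using B by (auto simp: \<C>_def)
  qed
  have C: "countable \<C>" "\<C> \<noteq> {}" using \<B>(1) cov by (auto simp: \<C>_def)
  define c where "c = from_nat_into \<C>"
  have c: "range c = \<C>" unfolding c_def by (rule range_from_nat_into[OF C(2,1)])
  have co: "open (c i)" "compact (closure (c i))" for i
    using c topological_basis_open[OF \<B>(2)] by (auto simp: \<C>_def)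
  show ?thesis
  proof (rule that[of "\<lambda>m. \<Union>i\<le>m. closure (c i)"])
    show "compact (\<Union>i\<le>m. closure (c i))" for m using co by (intro compact_UN) auto
    fix C :: "'g set" assume "compact C"
    moreover have "C \<subseteq> (\<Union>i\<in>UNIV. c i)" using cov c by blast
    ultimately obtain I where I: "finite I" "C \<subseteq> (\<Union>i\<in>I. c i)"
      using compactE_image[of C UNIV c] co(1) by metis
    obtain m where m: "\<And>i. i \<in> I \<Longrightarrow> i \<le> m" using finite_nat_set_iff_bounded_le[of I] I(1) by blast
    have "C \<subseteq> (\<Union>i\<le>n. closure (c i))" if "n \<ge> m" for n
    proof
      fix s assume "s \<in> C"
      then obtain i where i: "i \<in> I" "s \<in> c i" using I(2) by blast
      then show "s \<in> (\<Union>i\<le>n. closure (c i))"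
        using m[OF i(1)] that closure_subset[of "c i"] by (intro UN_I[of i]) auto
    qed
    then show "\<exists>m. \<forall>n\<ge>m. C \<subseteq> (\<Union>i\<le>n. closure (c i))" by blast
  qed
qed

end

subsection \<open>Separated returns in the orbit space\<close>

lemma limitin_fell_avoid:
  assumes "limitin (fell_topology G) Hn H F" "compact C" "C \<inter> H = {}"
  shows "\<forall>\<^sub>F n in F. C \<inter> Hn n = {}"
proof -
  have "is_fell_basic G (fell_basic G C {})" unfolding is_fell_basic_def using assms(2) by blast
  then have "openin (fell_topology G) (fell_basic G C {})"
    by (simp only: openin_fell_topology arbitrary_union_of_inc)
  moreover have "H \<in> closed_subgroups G" using assms(1) unfolding limitin_def topspace_fell_topology by blast
  then have "H \<in> fell_basic G C {}" using assms(3) by (simp add: fell_basic_def)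
  ultimately have "\<forall>\<^sub>F n in F. Hn n \<in> fell_basic G C {}" using assms(1) unfolding limitin_def by blast
  then show ?thesis by eventually_elim (simp add: fell_basic_def)
qed

lemma limitin_fell_hit:
  assumes "limitin (fell_topology G) Hn H F" "open A" "A \<inter> H \<noteq> {}"
  shows "\<forall>\<^sub>F n in F. Hn n \<inter> A \<noteq> {}"
proof -
  have "is_fell_basic G (fell_basic G {} {A})"
    unfolding is_fell_basic_def using assms(2,3) by (intro exI[of _ "{}"] exI[of _ "{A}"]) auto
  then have "openin (fell_topology G) (fell_basic G {} {A})"
    by (simp only: openin_fell_topology arbitrary_union_of_inc)
  moreover have "H \<in> closed_subgroups G" using assms(1) unfolding limitin_def topspace_fell_topology by blast
  then have "H \<in> fell_basic G {} {A}" using assms(3) by (auto simp: fell_basic_def)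
  ultimately have "\<forall>\<^sub>F n in F. Hn n \<in> fell_basic G {} {A}" using assms(1) unfolding limitin_def by blast
  then show ?thesis by eventually_elim (simp add: fell_basic_def)
qed

text \<open>In its use \<open>n\<close> is \<open>k - 1\<close>. For \<open>n = 0\<close> the value
  \<open>b = \<infinity>\<close> is taken, since \<open>0 * \<infinity> = 0\<close>; there
  \<open>a\<close> may be infinite as well, so \<open>a < b\<close> cannot be promised and the
  conclusion is a disjunction.\<close>

lemma ennreal_mult_less_between:
  fixes a L :: ennreal
  assumes "of_nat n * a < L"
  obtains b where "b = top_class.top \<or> a < b" "of_nat n * b < L"
proof (cases "n = 0")
  case True
  then show ?thesis using that[of top_class.top] assms by simp
next
  case False
  obtain c where c: "of_nat n * a < c" "c < L" using dense[OF assms] by blast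
  have eq: "of_nat n * (c / of_nat n) = c"
    using False ennreal_mult_divide_eq[of "of_nat n" c]
    by (simp add: ennreal_times_divide mult.commute ennreal_of_nat_eq_real_of_nat)
  have "a < c / of_nat n"
  proof (rule ccontr)
    assume "\<not> ?thesis"
    then have "of_nat n * (c / of_nat n) \<le> of_nat n * a" by (intro mult_left_mono) auto
    then show False using c(1) eq by simp
  qed
  then show ?thesis using that[of "c / of_nat n"] c(2) eq by simp
qed

text \<open>\<open>g n\<close> is the largest \<open>m \<le> n\<close> with \<open>Q m n\<close>.
  The inserted 0 covers the case that there is none, and \<open>Q 0 n\<close> holds
  eventually.\<close>

lemma eventually_diagonal:
  fixes Q :: "nat \<Rightarrow> nat \<Rightarrow> bool"
  assumes "\<And>m. \<forall>\<^sub>F n in sequentially. Q m n"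
  obtains g where "filterlim g at_top sequentially" "\<forall>\<^sub>F n in sequentially. Q (g n) n"
proof -
  define A where "A n = {m. m \<le> n \<and> Q m n}" for n
  define g where "g n = Max (insert 0 (A n))" for n
  have fin: "finite (A n)" for n by (simp add: A_def)
  have "\<forall>\<^sub>F n in sequentially. m \<le> g n" for m
    using assms[of m] eventually_ge_at_top[of m]
    by eventually_elim (auto simp: g_def A_def intro!: Max_ge)
  then have "filterlim g at_top sequentially" by (simp add: filterlim_at_top)
  moreover have "\<forall>\<^sub>F n in sequentially. Q (g n) n"
    using assms[of 0]
  proof eventually_elim
    case (elim n)
    have "g n \<in> insert 0 (A n)" unfolding g_def using fin by (intro Max_in) auto
    then show ?case using elim by (auto simp: A_def)
  qed
  ultimately show ?thesis by (rule that)
qed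

section \<open>Stabilizers and return sets of the action\<close>

sublocale transformation_group \<subseteq> lc_group G
proof -
  interpret group G by (rule group_hom.axioms(1)[OF group_hom])
  show "lc_group G"
    by unfold_locales (rule carrier_UNIV continuous_mult continuous_inv locally_compact_group)+
qed

context transformation_group
begin

lemma action_mult: "\<phi> (s \<otimes> t) y = \<phi> s (\<phi> t y)"
  by (rule composition_rule) simp_all

lemma action_one [simp]: "\<phi> \<one> y = y"
  using id_eq_one by (metis UNIV_I restrict_apply')

lemma action_inv [simp]: "\<phi> (inv s) (\<phi> s y) = y" "\<phi> s (\<phi> (inv s) y) = y"
  by (simp_all flip: action_mult)

lemma stabilizer_iff: "s \<in> stabilizer G \<phi> y \<longleftrightarrow> \<phi> s y = y"
  unfolding stabilizer_def by simp

lemma orbit_iff: "w \<in> orbit G \<phi> y \<longleftrightarrow> (\<exists>s. w = \<phi> s y)"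
  unfolding orbit_def by auto

lemma continuous_on_action [continuous_intros]:
  assumes "continuous_on S f" "continuous_on S g"
  shows "continuous_on S (\<lambda>p. \<phi> (f p) (g p))"
  using continuous_on_compose2[OF continuous_action continuous_on_Pair[OF assms]] by simp

lemma subgroup_stabilizer: "subgroup (stabilizer G \<phi> y) G"
  by (rule stabilizer_subgroup) simp

lemma closed_stabilizer: "closed (stabilizer G \<phi> y)"
proof -
  have "closed ((\<lambda>s. \<phi> s y) -` {y})"
    by (intro closed_vimage continuous_on_action continuous_on_id continuous_on_const) simp
  then show ?thesis by (simp add: vimage_def stabilizer_iff[abs_def] stabilizer_def)
qed

lemma coset_map_stabilizer_eq_iff:
  "coset_map G (stabilizer G \<phi> y) s = coset_map G (stabilizer G \<phi> y) t \<longleftrightarrow> \<phi> s y = \<phi> t y"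
  unfolding coset_map_eq_iff[OF subgroup_stabilizer] stabilizer_iff action_mult by (metis action_inv)

lemma closed_return: "closed W \<Longrightarrow> closed {s. \<phi> s y \<in> W}"
  using closed_vimage[of W "\<lambda>s. \<phi> s y"]
  by (simp add: vimage_def continuous_on_action continuous_on_id continuous_on_const)

text \<open>A return set is a union of cosets of the stabilizer, so it equals its own
  saturation.\<close>

lemma return_image_closedin:
  assumes "closed W"
  shows "closedin (coset_topology G (stabilizer G \<phi> y)) (coset_map G (stabilizer G \<phi> y) ` {s. \<phi> s y \<in> W})"
proof (rule closedin_coset_image[OF subgroup_stabilizer])
  have "{s. \<phi> s y \<in> W} <#> stabilizer G \<phi> y = {s. \<phi> s y \<in> W}"
    by (auto simp: mem_set_mult_iff[OF subgroup_stabilizer] image_iff coset_map_stabilizer_eq_iff)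
  then show "closed ({s. \<phi> s y \<in> W} <#> stabilizer G \<phi> y)" using closed_return[OF assms] by simp
qed

text \<open>Greedy choice: fewer than \<open>k\<close> returns exclude cosets of total mass at most
  \<open>(k - 1) * b\<close>, which is less than the mass of the return set, so a further return
  avoids the translates of all earlier ones.\<close>

lemma disjoint_translates:
  fixes k :: nat and b :: ennreal and W :: "'x set"
  defines "S \<equiv> \<lambda>y. stabilizer G \<phi> y"
  assumes n: "S y \<lhd> G" and N: "right_haar_measure (G Mod S y) (coset_topology G (S y)) N"
    and W: "closed W" and K: "compact K"
    and b: "\<And>s. \<phi> s y \<in> W \<Longrightarrow> emeasure N (coset_map G (S y) ` {c \<in> K. \<phi> c (\<phi> s y) \<in> W}) \<le> b"
    and big: "of_nat (k - 1) * b < emeasure N (coset_map G (S y) ` {s. \<phi> s y \<in> W})"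
  shows "\<exists>s. (\<forall>i<k. \<phi> (s i) y \<in> W) \<and> (\<forall>j<k. \<forall>i<j. \<phi> (s j) y \<notin> (\<lambda>c. \<phi> c (\<phi> (s i) y)) ` K)"
proof -
  let ?q = "coset_map G (S y)"
  have rN: "radon_measure (coset_topology G (S y)) N" using N unfolding right_haar_measure_def by blast
  have piece: "?q ` {c \<in> K. \<phi> c (\<phi> s y) \<in> W} \<in> sets N" for s
  proof (rule radon_closedin_sets[OF rN closedin_coset_image])
    have "{c \<in> K. \<phi> c (\<phi> s y) \<in> W} = K \<inter> {c. \<phi> c (\<phi> s y) \<in> W}" by auto
    then show "closed ({c \<in> K. \<phi> c (\<phi> s y) \<in> W} <#> S y)"
      using closed_set_mult[OF compact_Int_closed[OF K closed_return[OF W]] closed_stabilizer]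
      by (simp add: S_def)
  qed (simp add: S_def subgroup_stabilizer)
  \<comment> \<open>\<open>?T s\<close> is a right translate of the piece whose mass
    \<open>b\<close> bounds, so right invariance carries the bound over.\<close>
  let ?T = "\<lambda>s. ?q ` (\<lambda>c. c \<otimes> s) ` {c \<in> K. \<phi> c (\<phi> s y) \<in> W}"
  have T: "emeasure N (?T s) \<le> b" if "\<phi> s y \<in> W" for s
    using quotient_measure_translate[OF n N piece] b[OF that] by simp
  have TN: "?T s \<in> sets N" for s
  proof -
    have "{c \<in> K. \<phi> c (\<phi> s y) \<in> W} = K \<inter> {c. \<phi> c (\<phi> s y) \<in> W}" by auto
    then have "compact {c \<in> K. \<phi> c (\<phi> s y) \<in> W}"
      using compact_Int_closed[OF K closed_return[OF W]] by simp
    then have "compact ((\<lambda>c. c \<otimes> s) ` {c \<in> K. \<phi> c (\<phi> s y) \<in> W})"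
      by (intro compact_continuous_image continuous_intros)
    then show ?thesis
      by (intro radon_closedin_sets[OF rN closedin_coset_image] closed_set_mult)
        (simp_all add: S_def subgroup_stabilizer closed_stabilizer)
  qed
  have "\<exists>s. (\<forall>i<j. \<phi> (s i) y \<in> W) \<and> (\<forall>l<j. \<forall>i<l. \<phi> (s l) y \<notin> (\<lambda>c. \<phi> c (\<phi> (s i) y)) ` K)" if "j \<le> k" for j
    using that
  proof (induction j)
    case (Suc j)
    then obtain s where s: "\<forall>i<j. \<phi> (s i) y \<in> W"
      "\<forall>l<j. \<forall>i<l. \<phi> (s l) y \<notin> (\<lambda>c. \<phi> c (\<phi> (s i) y)) ` K" by auto
    have "\<exists>u. \<phi> u y \<in> W \<and> (\<forall>i<j. \<phi> u y \<notin> (\<lambda>c. \<phi> c (\<phi> (s i) y)) ` K)"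
    proof (rule ccontr)
      assume neg: "\<not> ?thesis"
      \<comment> \<open>The coset of a return is determined by the point it reaches, so a return
        reaching the \<open>K\<close>-translate of \<open>\<phi> (s i) y\<close> has its coset in
        \<open>?T (s i)\<close>.\<close>
      have "?q ` {u. \<phi> u y \<in> W} \<subseteq> (\<Union>i<j. ?T (s i))"
      proof safe
        fix u assume u: "\<phi> u y \<in> W"
        then obtain i c where ic: "i < j" "c \<in> K" "\<phi> u y = \<phi> c (\<phi> (s i) y)" using neg by blast
        then have "?q u = ?q (c \<otimes> s i)" by (simp add: S_def coset_map_stabilizer_eq_iff action_mult)
        moreover have "?q (c \<otimes> s i) \<in> ?T (s i)" using ic u by (intro imageI) simp
        ultimately show "?q u \<in> (\<Union>i<j. ?T (s i))" using ic(1) by auto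
      qed
      then have "emeasure N (?q ` {u. \<phi> u y \<in> W}) \<le> emeasure N (\<Union>i<j. ?T (s i))"
        using TN by (intro emeasure_mono) auto
      also have "\<dots> \<le> (\<Sum>i<j. emeasure N (?T (s i)))"
        using TN by (intro emeasure_subadditive_finite) auto
      also have "\<dots> \<le> (\<Sum>i<j. b)" using s(1) by (intro sum_mono T) simp
      also have "\<dots> = of_nat j * b" by simp
      also have "\<dots> \<le> of_nat (k - 1) * b" using Suc.prems by (intro mult_right_mono) auto
      finally show False using big by simp
    qed
    then obtain u where u: "\<phi> u y \<in> W" "\<And>i. i < j \<Longrightarrow> \<phi> u y \<notin> (\<lambda>c. \<phi> c (\<phi> (s i) y)) ` K" by blast
    show ?case
      by (rule exI[of _ "s(j := u)"]) (use s u in \<open>auto simp: less_Suc_eq\<close>)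
  qed simp
  then show ?thesis by blast
qed

text \<open>That \<open>c \<in> U\<close> or \<open>\<phi> c v \<notin> W\<close> is an open
  condition on \<open>(c, v)\<close> which holds on \<open>K \<times> {w}\<close>, hence on
  \<open>K\<close> times a neighbourhood of \<open>w\<close>.\<close>

lemma eventually_return_in_open:
  assumes K: "compact K" and W: "closed W" and U: "open U" "{c \<in> K. \<phi> c w \<in> W} \<subseteq> U"
    and y: "y \<longlonglongrightarrow> w"
  shows "\<forall>\<^sub>F n in sequentially. {c \<in> K. \<phi> c (y n) \<in> W} \<subseteq> U"
proof -
  let ?O = "{(c, v). c \<in> U \<or> \<phi> c v \<notin> W}"
  have "?O = (fst -` U) \<union> - ((\<lambda>p. \<phi> (fst p) (snd p)) -` W)" by auto
  then have "open ?O"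
    by (simp only:) (intro open_Un open_vimage_fst U open_Compl closed_vimage W continuous_intros)
  moreover have "K \<times> {w} \<subseteq> ?O" using U(2) by auto
  ultimately obtain A V where V: "open A" "open V" "K \<subseteq> A" "{w} \<subseteq> V" "A \<times> V \<subseteq> ?O"
    by (rule tube_compact_compact[OF K compact_sing])
  have "\<forall>\<^sub>F n in sequentially. y n \<in> V" using topological_tendstoD[OF y V(2)] V(4) by simp
  then show ?thesis by eventually_elim (use V in blast)
qed

lemma eventually_not_in_translate:
  assumes K: "compact K" and uv: "u \<longlonglongrightarrow> w" "v \<longlonglongrightarrow> w'" "w' \<notin> (\<lambda>c. \<phi> c w) ` K"
  shows "\<forall>\<^sub>F n in sequentially. v n \<notin> (\<lambda>c. \<phi> c (u n)) ` K"
proof -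
  let ?O = "{(c, p). \<phi> c (fst p) \<noteq> snd p}"
  have "?O = {q. \<phi> (fst q) (fst (snd q)) \<noteq> snd (snd q)}" by auto
  then have "open ?O" by (simp only:) (intro open_Collect_neq continuous_intros)
  moreover have "K \<times> {(w, w')} \<subseteq> ?O" using uv(3) by auto
  ultimately obtain A V where V: "open A" "open V" "K \<subseteq> A" "{(w, w')} \<subseteq> V" "A \<times> V \<subseteq> ?O"
    by (rule tube_compact_compact[OF K compact_sing])
  have "\<forall>\<^sub>F n in sequentially. (u n, v n) \<in> V"
    using topological_tendstoD[OF tendsto_Pair[OF uv(1,2)] V(2)] V(4) by simp
  then show ?thesis by eventually_elim (use V in fastforce)
qed

text \<open>
  Limits in \<open>G \<cdot> z\<close> are excluded by semicontinuity of the measures, since some \<open>K\<close>-translate carries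
  mass more than \<open>b\<close>. A limit \<open>w\<close> outside \<open>G \<cdot> z\<close> may occur along a subsequence, but then a smaller
  \<open>W m\<close> misses \<open>K \<cdot> w\<close> and the argument repeats there, so that \<open>k\<close> such limits already provide
  \<open>k\<close> separated points.
\<close>

lemma eventually_separated_returns:
  fixes x :: "nat \<Rightarrow> 'x" and z :: 'x and \<nu> :: "'x \<Rightarrow> 'g set measure" and k :: nat and W :: "nat \<Rightarrow> 'x set"
  defines "S \<equiv> \<lambda>y. stabilizer G \<phi> y"
  defines "q \<equiv> \<lambda>y. coset_map G (S y)"
  assumes usc: "\<And>A b. compact A \<Longrightarrow> emeasure (\<nu> z) (q z ` A) < b \<Longrightarrow>
      \<exists>U. open U \<and> A \<subseteq> U \<and> (\<forall>\<^sub>F n in sequentially. \<forall>B\<subseteq>U. emeasure (\<nu> (x n)) (q (x n) ` B) \<le> b)"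
    and n: "\<And>n. S (x n) \<lhd> G" "S z \<lhd> G"
    and N: "\<And>n. right_haar_measure (G Mod S (x n)) (coset_topology G (S (x n))) (\<nu> (x n))"
      "right_haar_measure (G Mod S z) (coset_topology G (S z)) (\<nu> z)"
    and W: "\<And>m. compact (W m)" "\<And>U. open U \<Longrightarrow> z \<in> U \<Longrightarrow> \<exists>m. W m \<subseteq> U" "decseq W"
    and big: "\<And>m. of_nat (k - 1) * emeasure (\<nu> z) (q z ` {s. \<phi> s z \<in> W m})
      < liminf (\<lambda>n. emeasure (\<nu> (x n)) (q (x n) ` {s. \<phi> s (x n) \<in> W m}))"
    and K: "compact K"
  shows "\<forall>\<^sub>F n in sequentially. \<exists>s. (\<forall>i<k. \<phi> (s i) (x n) \<in> W M) \<and>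
    (\<forall>j<k. \<forall>i<j. \<phi> (s j) (x n) \<notin> (\<lambda>c. \<phi> c (\<phi> (s i) (x n))) ` K)" (is "\<forall>\<^sub>F n in _. ?Q M n")
proof (rule ccontr)
  assume "\<not> ?thesis"
  \<comment> \<open>Failure happens along a subsequence, which is refined repeatedly below and keeps
    the failure at every index.\<close>
  then have "infinite {n. \<not> ?Q M n}"
    unfolding not_eventually cofinite_eq_sequentially[symmetric] frequently_cofinite .
  from infinite_enumerate[OF this] obtain r0 :: "nat \<Rightarrow> nat"
    where r0: "strict_mono r0" "\<forall>n. \<not> ?Q M (r0 n)" unfolding mem_Collect_eq by blast
  have clW: "closed (W m)" for m using W(1) by (rule compact_imp_closed)
  have rz: "radon_measure (coset_topology G (S z)) (\<nu> z)" using N(2) unfolding right_haar_measure_def by blast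
  \<comment> \<open>With \<open>w = \<phi> g z\<close>, right translation by \<open>g\<close>
    carries \<open>A\<close> into the return set of \<open>z\<close> without changing its mass. So
    this mass is below \<open>b\<close>, and semicontinuity passes the bound to the sets for
    \<open>y i\<close>.\<close>
  have near_orbit: "\<forall>\<^sub>F i in sequentially. emeasure (\<nu> (x (\<rho> i))) (q (x (\<rho> i)) ` {c \<in> K. \<phi> c (y i) \<in> W m}) \<le> b"
    if w: "w \<in> orbit G \<phi> z" and y: "y \<longlonglongrightarrow> w" and \<rho>: "strict_mono \<rho>"
      and b: "emeasure (\<nu> z) (q z ` {s. \<phi> s z \<in> W m}) < b"
    for w y m b and \<rho> :: "nat \<Rightarrow> nat"
  proof -
    obtain g where g: "w = \<phi> g z" using w orbit_iff by blast
    define A where "A = {c \<in> K. \<phi> c w \<in> W m}"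
    have "A = K \<inter> {c. \<phi> c w \<in> W m}" by (auto simp: A_def)
    then have A: "compact A" using compact_Int_closed[OF K closed_return[OF clW]] by simp
    have qA: "q z ` A \<in> sets (\<nu> z)" unfolding q_def S_def
      by (rule radon_closedin_sets[OF rz[unfolded S_def] closedin_coset_image[OF subgroup_stabilizer
          closed_set_mult[OF A closed_stabilizer]]])
    have "emeasure (\<nu> z) (q z ` A) = emeasure (\<nu> z) (q z ` (\<lambda>a. a \<otimes> g) ` A)"
      using quotient_measure_translate[OF n(2) N(2) qA[unfolded q_def]] by (simp add: q_def)
    also have "\<dots> \<le> emeasure (\<nu> z) (q z ` {s. \<phi> s z \<in> W m})"
    proof (rule emeasure_mono)
      show "q z ` (\<lambda>a. a \<otimes> g) ` A \<subseteq> q z ` {s. \<phi> s z \<in> W m}"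
        by (intro image_mono) (auto simp: A_def g action_mult)
      show "q z ` {s. \<phi> s z \<in> W m} \<in> sets (\<nu> z)" unfolding q_def S_def
        by (rule radon_closedin_sets[OF rz[unfolded S_def] return_image_closedin[OF clW]])
    qed
    finally have "emeasure (\<nu> z) (q z ` A) < b" using b by simp
    from usc[OF A this] obtain U where U: "open U" "A \<subseteq> U"
      "\<forall>\<^sub>F n in sequentially. \<forall>B\<subseteq>U. emeasure (\<nu> (x n)) (q (x n) ` B) \<le> b" by blast
    from eventually_return_in_open[OF K clW U(1) U(2)[unfolded A_def] y] eventually_subseq[OF \<rho> U(3)]
    show ?thesis by eventually_elim blast
  qed
  \<comment> \<open>The induction builds \<open>j\<close> returns along one common subsequence, with
    limits off the orbit of \<open>z\<close>, each limit avoiding the \<open>K\<close>-translates of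
    the earlier ones.\<close>
  have "\<exists>r s w. strict_mono (r :: nat \<Rightarrow> nat) \<and> (\<forall>n. \<not> ?Q M (r n)) \<and>
      (\<forall>i<j. (\<forall>n. \<phi> (s i n) (x (r n)) \<in> W M) \<and> (\<lambda>n. \<phi> (s i n) (x (r n))) \<longlonglongrightarrow> w i \<and> w i \<notin> orbit G \<phi> z) \<and>
      (\<forall>l<j. \<forall>i<l. w l \<notin> (\<lambda>c. \<phi> c (w i)) ` K)" for j :: nat
  proof (induction j)
    case 0
    then show ?case using r0 by auto
  next
    case (Suc j)
    then obtain r s w where r: "strict_mono (r :: nat \<Rightarrow> nat)" "\<forall>n. \<not> ?Q M (r n)"
      and s: "\<forall>i<j. (\<forall>n. \<phi> (s i n) (x (r n)) \<in> W M) \<and> (\<lambda>n. \<phi> (s i n) (x (r n))) \<longlonglongrightarrow> w i \<and> w i \<notin> orbit G \<phi> z"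
      and w: "\<forall>l<j. \<forall>i<l. w l \<notin> (\<lambda>c. \<phi> c (w i)) ` K" by blast
    \<comment> \<open>\<open>U\<close> contains \<open>z\<close>, since
      \<open>z = \<phi> c (w i)\<close> would put \<open>w i\<close> on the orbit of
      \<open>z\<close>. So some \<open>W m\<close> fits inside \<open>U\<close>, and any limit of
      returns to it is separated from the earlier limits.\<close>
    define U where "U = - (\<Union>i<j. (\<lambda>c. \<phi> c (w i)) ` K)"
    have "compact (\<Union>i<j. (\<lambda>c. \<phi> c (w i)) ` K)"
      by (intro compact_UN compact_continuous_image K continuous_on_action continuous_on_id continuous_on_const) simp
    then have "open U" unfolding U_def by (intro open_Compl compact_imp_closed)
    moreover have "z \<in> U"
    proof (rule ccontr)
      assume "z \<notin> U"
      then obtain i c where i: "i < j" "z = \<phi> c (w i)" unfolding U_def by blast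
      then have "w i = \<phi> (inv c) z" by simp
      then show False using s i(1) orbit_iff by blast
    qed
    ultimately obtain m0 where "W m0 \<subseteq> U" using W(2) by blast
    define m where "m = max m0 M"
    have m: "W m \<subseteq> U" "W m \<subseteq> W M"
      using \<open>W m0 \<subseteq> U\<close> decseqD[OF W(3), of m0 m] decseqD[OF W(3), of M m] by (auto simp: m_def)
    obtain b where b: "b = top_class.top \<or> emeasure (\<nu> z) (q z ` {s. \<phi> s z \<in> W m}) < b"
      "of_nat (k - 1) * b < liminf (\<lambda>n. emeasure (\<nu> (x n)) (q (x n) ` {s. \<phi> s (x n) \<in> W m}))"
      using ennreal_mult_less_between[OF big[of m]] by blast
    have "\<forall>\<^sub>F n in sequentially. of_nat (k - 1) * b < emeasure (\<nu> (x n)) (q (x n) ` {s. \<phi> s (x n) \<in> W m})"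
      by (rule less_LiminfD[OF b(2)])
    \<comment> \<open>If no \<open>K\<close>-translate of a return to \<open>W m\<close> carried
      more than \<open>b\<close>, \<open>disjoint_translates\<close> would give \<open>k\<close>
      separated returns to \<open>W m\<close>, hence to \<open>W M\<close>, against the failure at
      \<open>r n\<close>.\<close>
    from eventually_subseq[OF r(1) this]
    have "\<forall>\<^sub>F n in sequentially. \<exists>u. \<phi> u (x (r n)) \<in> W m \<and>
        b < emeasure (\<nu> (x (r n))) (q (x (r n)) ` {c \<in> K. \<phi> c (\<phi> u (x (r n))) \<in> W m})"
    proof eventually_elim
      case (elim n)
      show ?case
      proof (rule ccontr)
        assume neg: "\<not> ?thesis"
        have "?Q m (r n)"
          by (rule disjoint_translates[OF n(1)[unfolded S_def] N(1)[unfolded S_def] clW K, of _ _ b])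
            (use neg elim in \<open>auto simp: q_def S_def not_less\<close>)
        then have "?Q M (r n)" using m(2) by blast
        then show False using r(2) by blast
      qed
    qed
    then obtain n0 where "\<forall>n\<ge>n0. \<exists>u. \<phi> u (x (r n)) \<in> W m \<and>
        b < emeasure (\<nu> (x (r n))) (q (x (r n)) ` {c \<in> K. \<phi> c (\<phi> u (x (r n))) \<in> W m})"
      unfolding eventually_sequentially by blast
    then have "\<forall>n. \<exists>u. \<phi> u (x (r (n + n0))) \<in> W m \<and>
        b < emeasure (\<nu> (x (r (n + n0)))) (q (x (r (n + n0))) ` {c \<in> K. \<phi> c (\<phi> u (x (r (n + n0)))) \<in> W m})"
      by simp
    from choice[OF this] obtain u where "\<forall>n. \<phi> (u n) (x (r (n + n0))) \<in> W m \<and>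
        b < emeasure (\<nu> (x (r (n + n0)))) (q (x (r (n + n0))) ` {c \<in> K. \<phi> c (\<phi> (u n) (x (r (n + n0)))) \<in> W m})" ..
    then have u: "\<And>n. \<phi> (u n) (x (r (n + n0))) \<in> W m"
      "\<And>n. b < emeasure (\<nu> (x (r (n + n0)))) (q (x (r (n + n0))) ` {c \<in> K. \<phi> c (\<phi> (u n) (x (r (n + n0)))) \<in> W m})"
      by simp_all
    obtain v \<rho> where \<rho>: "v \<in> W m" "strict_mono (\<rho> :: nat \<Rightarrow> nat)" "((\<lambda>n. \<phi> (u n) (x (r (n + n0)))) \<circ> \<rho>) \<longlonglongrightarrow> v"
      by (rule seq_compactE[OF compact_imp_seq_compact[OF W(1)] allI[OF u(1)]])
    define \<sigma> where "\<sigma> n = \<rho> n + n0" for n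
    have \<sigma>: "strict_mono \<sigma>" using \<rho>(2) by (simp add: \<sigma>_def strict_mono_def)
    have r\<sigma>: "strict_mono (\<lambda>n. r (\<sigma> n))" using r(1) \<sigma> by (simp add: strict_mono_def)
    have lim: "(\<lambda>n. \<phi> (u (\<rho> n)) (x (r (\<sigma> n)))) \<longlonglongrightarrow> v" using \<rho>(3) by (simp add: o_def \<sigma>_def)
    have bv: "b < emeasure (\<nu> (x (r (\<sigma> n)))) (q (x (r (\<sigma> n))) ` {c \<in> K. \<phi> c (\<phi> (u (\<rho> n)) (x (r (\<sigma> n)))) \<in> W m})" for n
      using u(2)[of "\<rho> n"] by (simp add: \<sigma>_def)
    have v: "v \<notin> orbit G \<phi> z"
    proof
      assume "v \<in> orbit G \<phi> z"
      \<comment> \<open>Lying strictly below a measure, \<open>b\<close> is not infinite, so the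
        other alternative for it holds.\<close>
      moreover have "emeasure (\<nu> z) (q z ` {s. \<phi> s z \<in> W m}) < b"
        using b(1) bv[of 0] by (auto simp: not_less[symmetric])
      ultimately have "\<forall>\<^sub>F n in sequentially.
          emeasure (\<nu> (x (r (\<sigma> n)))) (q (x (r (\<sigma> n))) ` {c \<in> K. \<phi> c (\<phi> (u (\<rho> n)) (x (r (\<sigma> n)))) \<in> W m}) \<le> b"
        by (rule near_orbit[OF _ lim r\<sigma>])
      then have "\<forall>\<^sub>F n :: nat in sequentially. False"
        by (rule eventually_mono) (erule leD[THEN notE, OF _ bv])
      then show False by simp
    qed
    define s' where "s' i n = (if i = j then u (\<rho> n) else s i (\<sigma> n))" for i n
    define w' where "w' = w(j := v)"
    have "(\<forall>n. \<phi> (s' i n) (x (r (\<sigma> n))) \<in> W M) \<and> (\<lambda>n. \<phi> (s' i n) (x (r (\<sigma> n)))) \<longlonglongrightarrow> w' i \<and> w' i \<notin> orbit G \<phi> z"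
      if "i < Suc j" for i
    proof (cases "i = j")
      case True
      have "\<phi> (u (\<rho> n)) (x (r (\<sigma> n))) \<in> W M" for n using u(1)[of "\<rho> n"] m(2) by (auto simp: \<sigma>_def)
      then show ?thesis using True lim v by (simp add: s'_def w'_def)
    next
      case False
      then have "i < j" using that by simp
      then show ?thesis using s LIMSEQ_subseq_LIMSEQ[OF _ \<sigma>, of "\<lambda>n. \<phi> (s i n) (x (r n))" "w i"] False
        by (auto simp: s'_def w'_def o_def)
    qed
    moreover have "w' l \<notin> (\<lambda>c. \<phi> c (w' i)) ` K" if "l < Suc j" "i < l" for l i
    proof (cases "l = j")
      case True
      then have "v \<notin> (\<lambda>c. \<phi> c (w i)) ` K" using \<rho>(1) m(1) that unfolding U_def by blast
      then show ?thesis using True that by (simp add: w'_def)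
    next
      case False
      then show ?thesis using w that by (simp add: w'_def)
    qed
    ultimately show ?case using r\<sigma> r(2)
      by (intro exI[of _ "\<lambda>n. r (\<sigma> n)"] exI[of _ s'] exI[of _ w']) blast
  qed
  \<comment> \<open>For \<open>j = k\<close> the limits are separated, so the returns converging to
    them are separated for large \<open>n\<close>, contrary to the failure along
    \<open>r\<close>.\<close>
  from this[of k] obtain r s w where r: "\<forall>n. \<not> ?Q M (r n)"
    and s: "\<forall>i<k. (\<forall>n. \<phi> (s i n) (x (r n)) \<in> W M) \<and> (\<lambda>n. \<phi> (s i n) (x (r n))) \<longlonglongrightarrow> w i"
    and w: "\<forall>l<k. \<forall>i<l. w l \<notin> (\<lambda>c. \<phi> c (w i)) ` K" by blast
  have "\<forall>\<^sub>F n in sequentially. \<forall>l\<in>{..<k}. \<forall>i\<in>{..<l}.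
      \<phi> (s l n) (x (r n)) \<notin> (\<lambda>c. \<phi> c (\<phi> (s i n) (x (r n)))) ` K"
  proof (intro eventually_ball_finite ballI)
    fix l i assume "l \<in> {..<k}" "i \<in> {..<l}"
    then show "\<forall>\<^sub>F n in sequentially. \<phi> (s l n) (x (r n)) \<notin> (\<lambda>c. \<phi> c (\<phi> (s i n) (x (r n)))) ` K"
      using s w by (intro eventually_not_in_translate[OF K, of _ "w i" _ "w l"]) auto
  qed simp_all
  then obtain n where "\<forall>l\<in>{..<k}. \<forall>i\<in>{..<l}. \<phi> (s l n) (x (r n)) \<notin> (\<lambda>c. \<phi> c (\<phi> (s i n) (x (r n)))) ` K"
    unfolding eventually_sequentially by blast
  then have "?Q M (r n)" using s by (intro exI[of _ "\<lambda>i. s i n"]) simp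
  then show False using r by blast
qed

end

section \<open>From separated returns to \<open>k\<close>-times convergence\<close>

theorem proposition3p5:
  fixes G :: "'g::{second_countable_topology,t2_space} monoid"
    and \<phi> :: "'g \<Rightarrow> 'x::{second_countable_topology,t2_space} \<Rightarrow> 'x"
    and \<mu> :: "'g measure"
    and f0 :: "'g \<Rightarrow> real"
    and \<alpha> :: "'g set \<Rightarrow> 'g measure"
    and \<nu> :: "'x \<Rightarrow> 'g set measure"
    and x :: "nat \<Rightarrow> 'x" and z :: 'x
    and k :: nat
    and W :: "nat \<Rightarrow> 'x set"
  assumes "transformation_group G \<phi>"
    and "left_haar_measure G euclidean \<mu>"
    and "f0 \<in> Cc" and "f0 \<one>\<^bsub>G\<^esub> = 1" and "\<forall>s. 0 \<le> f0 s \<and> f0 s \<le> 1"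
    and "normalized_haar_family G f0 \<alpha>"
    and "openin (top_of_set (closure (orbit G \<phi> z))) (orbit G \<phi> z)"
    and "compact (stabilizer G \<phi> z)"
    and "limitin (fell_topology G) (\<lambda>n. stabilizer G \<phi> (x n)) (stabilizer G \<phi> z) sequentially"
    and "stabilizer G \<phi> z \<lhd> G" and "\<forall>n. stabilizer G \<phi> (x n) \<lhd> G"
    and "\<forall>y \<in> insert z (range x).
           compatible_quotient_haar G \<mu> (\<alpha> (stabilizer G \<phi> y)) (stabilizer G \<phi> y) (\<nu> y)"
    and "\<forall>L. limitin (orbit_space G \<phi>) (\<lambda>n. orbit G \<phi> (x n)) L sequentially
           \<longleftrightarrow> L = orbit G \<phi> z"
    and "k \<ge> 1"
    and "\<forall>m. compact (W m) \<and> z \<in> interior (W m)"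
    and "\<forall>U. open U \<and> z \<in> U \<longrightarrow> (\<exists>m. W m \<subseteq> U)"
    and "\<forall>m. W (Suc m) \<subseteq> W m"
    and "\<forall>m. liminf (\<lambda>n. emeasure (\<nu> (x n))
                  (coset_map G (stabilizer G \<phi> (x n)) ` {s \<in> carrier G. \<phi> s (x n) \<in> W m}))
           > of_nat (k - 1) * emeasure (\<nu> z)
                  (coset_map G (stabilizer G \<phi> z) ` {s \<in> carrier G. \<phi> s z \<in> W m})"
  shows "k_times_convergent G \<phi> k x z"
proof -
  interpret transformation_group G \<phi> by fact
  define S where "S y = stabilizer G \<phi> y" for y
  define q where "q y = coset_map G (S y)" for y
  have S: "subgroup (S y) G" "closed (S y)" for y
    by (simp_all add: S_def subgroup_stabilizer closed_stabilizer)
  have \<alpha>: "left_haar_measure (G\<lparr>carrier := S y\<rparr>) (top_of_set (S y)) (\<alpha> (S y))"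
    "(\<integral>t. f0 t \<partial>\<alpha> (S y)) = 1" for y
    using assms(6) S unfolding normalized_haar_family_def closed_subgroups_def by auto
  have N: "compatible_quotient_haar G \<mu> (\<alpha> (S y)) (S y) (\<nu> y)" if "y \<in> insert z (range x)" for y
    using assms(12) that unfolding S_def by blast
  have Nn: "compatible_quotient_haar G \<mu> (\<alpha> (S (x n))) (S (x n)) (\<nu> (x n))" for n by (rule N) simp
  have Nz: "compatible_quotient_haar G \<mu> (\<alpha> (S z)) (S z) (\<nu> z)" by (rule N) simp
  have R: "right_haar_measure (G Mod S y) (coset_topology G (S y)) (\<nu> y)" if "y \<in> insert z (range x)" for y
    using N[OF that] unfolding compatible_quotient_haar_def by blast
  have Sz: "compact (S z)" using assms(8) by (simp add: S_def)
  have fell: "limitin (fell_topology G) (\<lambda>n. S (x n)) (S z) sequentially" using assms(9) by (simp add: S_def)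
  have usc: "\<exists>U. open U \<and> A \<subseteq> U \<and> (\<forall>\<^sub>F n in sequentially. \<forall>B\<subseteq>U. emeasure (\<nu> (x n)) (q (x n) ` B) \<le> b)"
    if A: "compact A" "emeasure (\<nu> z) (q z ` A) < b" for A b
  proof -
    have qA: "emeasure (\<nu> z) (coset_map G (S z) ` A) < b" using A(2) by (simp add: q_def)
    obtain U where "open U" "A \<subseteq> U"
      "\<forall>\<^sub>F n in sequentially. \<forall>B\<subseteq>U. emeasure (\<nu> (x n)) (coset_map G (S (x n)) ` B) \<le> b"
      by (rule quotient_measure_usc[of "\<lambda>n. S (x n)" "S z" "\<lambda>n. \<alpha> (S (x n))" "\<alpha> (S z)" f0 \<mu>
          "\<lambda>n. \<nu> (x n)" "\<nu> z", OF S(1,2,1) Sz limitin_fell_avoid[OF fell] limitin_fell_hit[OF fell]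
          \<alpha>(1,1) assms(3) \<alpha>(2,2) Nn Nz A(1) qA])
    then show ?thesis unfolding q_def by blast
  qed
  have dec: "decseq W" using assms(17) by (simp add: decseq_SucI)
  obtain K :: "nat \<Rightarrow> 'g set" where K: "\<And>m. compact (K m)" "\<And>C. compact C \<Longrightarrow> \<exists>m. \<forall>n\<ge>m. C \<subseteq> K n"
    using compact_exhaustion by blast
  \<comment> \<open>The neighbourhood and the compact set share the index \<open>m\<close>, so that
    as \<open>g n\<close> grows the points approach \<open>z\<close> while the separation outgrows
    every compact set.\<close>
  define Q where "Q m n \<longleftrightarrow> (\<exists>s. (\<forall>i<k. \<phi> (s i) (x n) \<in> W m) \<and>
    (\<forall>j<k. \<forall>i<j. \<phi> (s j) (x n) \<notin> (\<lambda>c. \<phi> c (\<phi> (s i) (x n))) ` K m))" for m n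
  have "\<forall>\<^sub>F n in sequentially. Q m n" for m
    unfolding Q_def
  proof (rule eventually_separated_returns[where \<nu> = \<nu> and z = z, folded S_def, folded q_def])
    show "of_nat (k - 1) * emeasure (\<nu> z) (q z ` {s. \<phi> s z \<in> W m})
      < liminf (\<lambda>n. emeasure (\<nu> (x n)) (q (x n) ` {s. \<phi> s (x n) \<in> W m}))" for m
      using assms(18) by (simp add: q_def S_def)
  qed (use usc R assms(10,11,15,16) dec K in \<open>auto simp: S_def\<close>)
  then obtain g where g: "filterlim g at_top sequentially" "\<forall>\<^sub>F n in sequentially. Q (g n) n"
    using eventually_diagonal by blast
  \<comment> \<open>The choice has the desired property only for large \<open>n\<close>; its other
    values are arbitrary and affect no limit.\<close>
  define \<tau> where "\<tau> n = (SOME s. (\<forall>i<k. \<phi> (s i) (x n) \<in> W (g n)) \<and>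
    (\<forall>j<k. \<forall>i<j. \<phi> (s j) (x n) \<notin> (\<lambda>c. \<phi> c (\<phi> (s i) (x n))) ` K (g n)))" for n
  have \<tau>: "\<forall>\<^sub>F n in sequentially. (\<forall>i<k. \<phi> (\<tau> n i) (x n) \<in> W (g n)) \<and>
    (\<forall>j<k. \<forall>i<j. \<phi> (\<tau> n j) (x n) \<notin> (\<lambda>c. \<phi> c (\<phi> (\<tau> n i) (x n))) ` K (g n))"
    using g(2)
  proof eventually_elim
    case (elim n)
    from someI_ex[OF elim[unfolded Q_def]] show ?case unfolding \<tau>_def .
  qed
  have ge: "\<forall>\<^sub>F n in sequentially. m \<le> g n" for m using g(1) by (simp add: filterlim_at_top)
  have "(\<lambda>n. \<phi> (\<tau> n i) (x n)) \<longlonglongrightarrow> z" if "i < k" for i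
  proof (rule topological_tendstoI)
    fix U assume "open U" "z \<in> U"
    then obtain m where m: "W m \<subseteq> U" using assms(16) by blast
    from \<tau> ge[of m] show "\<forall>\<^sub>F n in sequentially. \<phi> (\<tau> n i) (x n) \<in> U"
    proof eventually_elim
      case (elim n)
      then show ?case using decseqD[OF dec elim(2)] m that by blast
    qed
  qed
  moreover have "\<forall>\<^sub>F n in sequentially. ((\<tau> n j \<otimes>\<^bsub>G\<^esub> inv\<^bsub>G\<^esub> \<tau> n i) <#\<^bsub>G\<^esub> S (x n)) \<inter> C = {}"
    if ij: "i < j" "j < k" and C: "compact C" for i j C
  proof -
    obtain m where m: "\<forall>n\<ge>m. C \<subseteq> K n" using K(2)[OF C] by blast
    from \<tau> ge[of m] show ?thesis
    proof eventually_elim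
      case (elim n)
      have "c \<notin> C" if c: "c \<in> (\<tau> n j \<otimes>\<^bsub>G\<^esub> inv\<^bsub>G\<^esub> \<tau> n i) <#\<^bsub>G\<^esub> S (x n)" for c
      proof
        assume "c \<in> C"
        obtain h where h: "h \<in> S (x n)" "c = \<tau> n j \<otimes>\<^bsub>G\<^esub> inv\<^bsub>G\<^esub> \<tau> n i \<otimes>\<^bsub>G\<^esub> h"
          using c unfolding l_coset_def by blast
        \<comment> \<open>By normality the conjugate of \<open>h\<close> by
          \<open>\<tau> n i\<close> still fixes \<open>x n\<close>, so \<open>c\<close> moves
          \<open>\<phi> (\<tau> n i) (x n)\<close> to \<open>\<phi> (\<tau> n j) (x n)\<close>,
          which no element of \<open>K (g n)\<close> does.\<close>
        have "inv\<^bsub>G\<^esub> \<tau> n i \<otimes>\<^bsub>G\<^esub> h \<otimes>\<^bsub>G\<^esub> \<tau> n i \<in> S (x n)"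
          using normal.inv_op_closed1[of "S (x n)" G "\<tau> n i" h] assms(11) h(1) by (simp add: S_def)
        then have "\<phi> (inv\<^bsub>G\<^esub> \<tau> n i) (\<phi> h (\<phi> (\<tau> n i) (x n))) = x n"
          by (simp add: S_def stabilizer_iff action_mult)
        then have "\<phi> (\<tau> n j) (x n) = \<phi> c (\<phi> (\<tau> n i) (x n))" by (simp add: h(2) action_mult)
        moreover have "c \<in> K (g n)" using m elim(2) \<open>c \<in> C\<close> by blast
        ultimately show False using elim(1) ij by blast
      qed
      then show ?case by blast
    qed
  qed
  \<comment> \<open>The definition of convergence numbers the sequences from 1, while
    \<open>\<tau>\<close> numbers the returns from 0.\<close>
  ultimately show ?thesis
    unfolding k_times_convergent_def S_def
    by (intro exI[of _ "\<lambda>i n. \<tau> n (i - 1)"]) (auto simp: carrier_UNIV)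
qed

end
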